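(* Let $G$ be a finite simple 2-connected graph with minimum degree $\delta$, let $p$ be the order (number of vertices) of a longest path in $G$, and let $c$ be the circumference of $G$ (the order of a longest cycle in $G$). Then $$ c\ge\begin{cases} p & \text{if } p\le 2\delta,\\[2pt] p-1 & \text{if } 2\delta+1\le p\le 3\delta-2,\\[2pt] \sqrt{2p-10+\left(\delta-\frac{7}{2}\right)^2}+\delta+\frac{1}{2} & \text{if } p\ge 3\delta-1. \end{cases} $$
   Context: Graphs are finite, undirected, without loops or multiple edges. The order of a path or cycle is its number of vertices. *)

theory Defs
  imports
    Complex_Main
    "Graph_Theory.Digraph_Component"
    "Graph_Theory.Vertex_Walk"
begin

text \<open>
  Finite simple undirected graphs are those of the locale \<^locale>\<open>graph\<close>: every edge is
  represented by its two opposite arcs, so the degree of a vertex is its out-degree.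
\<close>

definition min_degree :: "('a, 'b) pre_digraph \<Rightarrow> nat" where
  "min_degree G = Min (out_degree G ` verts G)"

text \<open>
  The bound on the number of vertices excludes complete graphs on at most \<open>k\<close> vertices;
  in particular the complete graph on two vertices, which has no cycle, is not 2-connected.
  The qualified name distinguishes graph connectedness from the topological notion.
\<close>

definition k_connected :: "nat \<Rightarrow> ('a, 'b) pre_digraph \<Rightarrow> bool" where
  "k_connected k G \<longleftrightarrow> k < card (verts G) \<and>
     (\<forall>X \<subseteq> verts G. card X < k \<longrightarrow> Digraph_Component.connected (G \<restriction> (verts G - X)))"

definition longest_path_order :: "('a, 'b) pre_digraph \<Rightarrow> nat" where
  "longest_path_order G = Max {length xs | xs. vpath xs G}"

text \<open>
  A directed cycle is a list of arcs, and its length is its number of vertices. Traversing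
  an edge back and forth is a directed cycle of length 2 but not a cycle of the
  undirected graph, hence the lower bound 3. A graph without cycles has no circumference;
  the value is then unspecified.
\<close>

definition circumference :: "('a, 'b) pre_digraph \<Rightarrow> nat" where
  "circumference G = Max {length es | es. pre_digraph.cycle G es \<and> 3 \<le> length es}"

end

theory Submission
  imports Defs
begin

text \<open>
  Let \<open>P = x\<^sub>0 \<dots> x\<^sub>p\<^sub>-\<^sub>1\<close> be a longest path.

  Choose \<open>P\<close> such that the largest index \<open>a\<close> of a neighbour of \<open>x\<^sub>0\<close> is maximal over all longest paths.
  If \<open>a + 1 < 2\<delta>\<close> and \<open>a + 1 < p\<close>, rotations show that every vertex before \<open>x\<^sub>a\<close> is the end of a longest
  path that agrees with \<open>P\<close> from \<open>x\<^sub>a\<close> on, hence has no neighbour behind \<open>x\<^sub>a\<close>, and \<open>x\<^sub>a\<close> is a cut vertex.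
  So \<open>c \<ge> a + 1 \<ge> min p (2\<delta>)\<close>.

  Suppose \<open>c \<le> p - 2\<close>, and let \<open>b\<close> be the smallest index of a neighbour of \<open>x\<^sub>p\<^sub>-\<^sub>1\<close>. If \<open>a \<le> b\<close>, then
  \<open>p \<ge> 3\<delta>\<close>. Otherwise \<open>P\<close> is covered by a cycle \<open>C\<close> and a disjoint path \<open>Q\<close> whose ends have distinct
  neighbours on \<open>C\<close>. Take such a pair with \<open>C\<close> longest, and \<open>m = |Q| \<ge> 2\<close>. Neighbours on \<open>C\<close> of different
  ends of \<open>Q\<close> are at least \<open>m + 1\<close> apart, those of the same end at least \<open>2\<close>, and counting along \<open>C\<close>
  gives \<open>p \<ge> 3\<delta> - 1\<close>.

  For the last bound take a vine on \<open>P\<close>, that is, overlapping connections \<open>L\<^sub>1, \<dots>, L\<^sub>m\<close> outside \<open>P\<close> that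
  lead from \<open>x\<^sub>0\<close> to \<open>x\<^sub>p\<^sub>-\<^sub>1\<close>, each reaching as far as possible. The cycle through the whole vine can be
  made to contain all neighbours of both ends of \<open>P\<close>, so \<open>c \<ge> 2\<delta> + m - 2\<close>. Adding the lengths of
  \<open>m + 1\<close> cycles that together cover \<open>P\<close> twice yields \<open>(m + 1) (c - 4) \<ge> 2p - 10\<close>. Hence
  \<open>(c - 2\<delta> + 3) (c - 4) \<ge> 2p - 10\<close>, which is the bound after completing the square.
\<close>

section \<open>Ends of longest paths\<close>

locale ugraph =
  fixes V :: "'a set" and adj :: "'a \<Rightarrow> 'a \<Rightarrow> bool"
  assumes adj_sym: "adj x y \<Longrightarrow> adj y x"
    and adj_irrefl: "\<not> adj x x"
    and adj_V: "adj x y \<Longrightarrow> x \<in> V"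
begin

definition is_path :: "'a list \<Rightarrow> bool" where
  "is_path xs \<longleftrightarrow> xs \<noteq> [] \<and> distinct xs \<and> successively adj xs \<and> set xs \<subseteq> V"

definition is_cycle :: "'a list \<Rightarrow> bool" where
  "is_cycle xs \<longleftrightarrow> is_path xs \<and> 3 \<le> length xs \<and> adj (last xs) (hd xs)"

lemma adj_commute: "adj x y \<longleftrightarrow> adj y x"
  using adj_sym by blast

lemma adj_V2: "adj x y \<Longrightarrow> y \<in> V"
  using adj_sym adj_V by blast

lemma successively_adj_flip: "successively (\<lambda>x y. adj y x) xs = successively adj xs"
  by (rule successively_cong) (auto simp: adj_commute)

lemma is_path_rev [simp]: "is_path (rev xs) = is_path xs"
  by (simp add: is_path_def successively_adj_flip)

lemma is_cycle_rotate: "is_cycle (ys @ zs) \<Longrightarrow> is_cycle (zs @ ys)"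
  unfolding is_cycle_def is_path_def
  by (cases "ys = []"; cases "zs = []") (auto simp: successively_append_iff)

lemma is_cycle_split:
  assumes "is_cycle C" "x \<in> set C"
  obtains r where "is_cycle (x # r)" "set (x # r) = set C" "length (x # r) = length C"
proof -
  obtain ys zs where C: "C = ys @ x # zs"
    using assms(2) by (meson split_list)
  show thesis
    using that[of "zs @ ys"] is_cycle_rotate[of ys "x # zs"] assms C by auto
qed

end

text \<open>The numbers \<open>\<delta>\<close>, \<open>p\<close> and \<open>c\<close> enter only
  through inequalities; that \<open>p\<close> is attained is assumed separately where a longest path
  is given. \<open>no_cut_vertex\<close> states connectedness of the graph minus \<open>w\<close>
  through edges leaving a vertex set.\<close>

locale two_connected_graph = ugraph +
  fixes \<delta> p c :: nat
  assumes two_le_degree: "2 \<le> \<delta>"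
    and degree_ge: "v \<in> V \<Longrightarrow> \<delta> \<le> card {w. adj v w}"
    and no_cut_vertex: "\<lbrakk>w \<in> V; X \<subseteq> V - {w}; X \<noteq> {}; X \<noteq> V - {w}\<rbrakk>
      \<Longrightarrow> \<exists>x\<in>X. \<exists>y\<in>V - {w} - X. adj x y"
    and path_length_le: "is_path xs \<Longrightarrow> length xs \<le> p"
    and cycle_length_le: "is_cycle xs \<Longrightarrow> length xs \<le> c"
begin

lemma hd_nbr_in_longest_path:
  assumes "is_path ys" "length ys = p" "adj (hd ys) w"
  shows "w \<in> set ys"
proof (rule ccontr)
  assume "w \<notin> set ys"
  then have "is_path (w # ys)"
    using assms adj_sym[OF assms(3)] adj_V2[OF assms(3)] by (auto simp: is_path_def successively_Cons)
  then show False
    using path_length_le[of "w # ys"] assms by simp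
qed

lemma last_nbr_in_longest_path:
  assumes "is_path ys" "length ys = p" "adj (last ys) w"
  shows "w \<in> set ys"
  using hd_nbr_in_longest_path[of "rev ys" w] assms by (simp add: hd_rev)

text \<open>The bound ranges over all longest paths so that it still applies to the reordered paths
  in \<open>block_start_nbr\<close>.\<close>

definition first_nbrs_le :: "nat \<Rightarrow> bool" where
  "first_nbrs_le a \<longleftrightarrow>
     (\<forall>ys j. is_path ys \<longrightarrow> length ys = p \<longrightarrow> j < p \<longrightarrow> adj (ys ! 0) (ys ! j) \<longrightarrow> j \<le> a)"

end

locale longest_path = two_connected_graph +
  fixes xs :: "'a list"
  assumes path_xs: "is_path xs"
    and length_xs: "length xs = p"
begin

text \<open>With indices, stretches of the path become intervals \<open>[i..<j]\<close>, and
  building paths and cycles becomes list computation.\<close>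

definition nb :: "nat \<Rightarrow> nat \<Rightarrow> bool" where
  "nb i j \<longleftrightarrow> i < p \<and> j < p \<and> adj (xs ! i) (xs ! j)"

lemma nb_sym: "nb i j = nb j i"
  using adj_commute by (auto simp: nb_def)

lemma nb_irrefl [simp]: "\<not> nb i i"
  by (simp add: nb_def adj_irrefl)

lemma nb_less: "nb i j \<Longrightarrow> i < p \<and> j < p"
  by (simp add: nb_def)

lemma distinct_xs: "distinct xs" and xs_nonempty: "xs \<noteq> []" and set_xs: "set xs \<subseteq> V"
  using path_xs by (auto simp: is_path_def)

lemma p_pos: "0 < p"
  using xs_nonempty length_xs by auto

lemma nb_Suc: "Suc i < p \<Longrightarrow> nb i (Suc i)"
  using path_xs length_xs by (auto simp: nb_def is_path_def successively_conv_nth)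

lemma nth_xs_in_V: "i < p \<Longrightarrow> xs ! i \<in> V"
  using set_xs length_xs by (auto simp: subset_iff)

lemma nth_xs_eq: "i < p \<Longrightarrow> j < p \<Longrightarrow> xs ! i = xs ! j \<longleftrightarrow> i = j"
  using distinct_xs length_xs by (simp add: nth_eq_iff_index_eq)

lemma successively_nb_upt [simp]: "j \<le> p \<Longrightarrow> successively nb [i..<j]"
  using nb_Suc by (auto simp: successively_conv_nth)

lemma successively_nb_upt_flip [simp]: "j \<le> p \<Longrightarrow> successively (\<lambda>x y. nb y x) [i..<j]"
  using nb_Suc by (auto simp: successively_conv_nth nb_sym)

lemma successively_adj_map:
  "set is \<subseteq> {..<p} \<Longrightarrow> successively nb is \<Longrightarrow> successively adj (map ((!) xs) is)"
  unfolding successively_map by (erule successively_mono) (auto simp: nb_def)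

lemma distinct_map_nth: "set is \<subseteq> {..<p} \<Longrightarrow> distinct is \<Longrightarrow> distinct (map ((!) xs) is)"
  by (auto simp: distinct_map inj_on_def nth_xs_eq subset_iff)

lemma is_path_map_nth:
  assumes "is \<noteq> []" "distinct is" "set is \<subseteq> {..<p}" "successively nb is"
  shows "is_path (map ((!) xs) is)"
  using assms distinct_map_nth successively_adj_map nth_xs_in_V
  by (auto simp: is_path_def)

lemma is_cycle_map_nth:
  assumes "distinct is" "set is \<subseteq> {..<p}" "successively nb is" "3 \<le> length is"
    "nb (last is) (hd is)"
  shows "is_cycle (map ((!) xs) is)"
proof -
  have ne: "is \<noteq> []" using assms(4) by auto
  show ?thesis
    using is_path_map_nth[OF ne assms(1-3)] assms(4,5) ne
    by (auto simp: is_cycle_def last_map hd_map nb_def)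
qed

lemma index_cycle_le:
  assumes "distinct is" "set is \<subseteq> {..<p}" "successively nb is" "3 \<le> length is"
    "nb (last is) (hd is)"
  shows "length is \<le> c"
  using cycle_length_le[OF is_cycle_map_nth[OF assms]] by simp

lemma finite_nb: "finite {j. nb i j}"
  by (rule finite_subset[of _ "{..<p}"]) (auto simp: nb_def)

lemma degree_le_index:
  assumes "i < p" "\<And>w. adj (xs ! i) w \<Longrightarrow> w \<in> set xs"
  shows "\<delta> \<le> card {j. nb i j}"
proof -
  have "{w. adj (xs ! i) w} = (!) xs ` {j. nb i j}"
    using assms by (auto simp: nb_def set_conv_nth length_xs)
  then have "card {w. adj (xs ! i) w} \<le> card {j. nb i j}"
    using finite_nb by (simp add: card_image_le)
  then show ?thesis
    using degree_ge[OF nth_xs_in_V[OF assms(1)]] by simp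
qed

lemma first_nbr_in_xs: "adj (xs ! 0) w \<Longrightarrow> w \<in> set xs"
  using hd_nbr_in_longest_path[OF path_xs length_xs] xs_nonempty by (simp add: hd_conv_nth)

lemma last_nbr_in_xs: "adj (xs ! (p - 1)) w \<Longrightarrow> w \<in> set xs"
  using last_nbr_in_longest_path[OF path_xs length_xs] xs_nonempty length_xs
  by (simp add: last_conv_nth)

lemma degree_first: "\<delta> \<le> card {j. nb 0 j}"
  using degree_le_index first_nbr_in_xs p_pos by blast

lemma degree_last: "\<delta> \<le> card {j. nb (p - 1) j}"
  using degree_le_index last_nbr_in_xs p_pos by simp

section \<open>Rotations of the initial segment\<close>

text \<open>
  A vertex of the initial segment \<open>x\<^sub>0, \<dots>, x\<^sub>a\<^sub>-\<^sub>1\<close> starts a block if the segment can be reordered into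
  a path that begins there and still continues with \<open>x\<^sub>a\<close>. It is then the first vertex of another
  longest path that agrees with the given one from \<open>x\<^sub>a\<close> on.
\<close>

definition block_start :: "nat \<Rightarrow> nat \<Rightarrow> bool" where
  "block_start a s \<longleftrightarrow>
     (\<exists>is. distinct is \<and> set is = {..<a} \<and> is \<noteq> [] \<and> hd is = s \<and> successively nb (is @ [a]))"

text \<open>The reordered segment followed by the rest of the path is a longest path starting in
  \<open>x_s\<close>, so maximality of \<open>a\<close> confines the neighbours of
  \<open>x_s\<close> to its first \<open>a + 1\<close> positions. These carry exactly the indices up
  to \<open>a\<close>.\<close>

lemma block_start_nbr:
  assumes max: "first_nbrs_le a"
    and "a < p" "block_start a s" "adj (xs ! s) w"
  shows "\<exists>j\<le>a. w = xs ! j"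
proof -
  obtain "is" where is': "distinct is" "set is = {..<a}" "is \<noteq> []" "hd is = s"
    "successively nb (is @ [a])"
    using assms(3) by (auto simp: block_start_def)
  have len: "length is = a"
    using distinct_card[OF is'(1)] is'(2) by (metis card_lessThan)
  define ks where "ks = is @ [a..<p]"
  have "length ks = p"
    using \<open>a < p\<close> by (simp add: ks_def len)
  moreover have "set ks = {..<p}"
    using \<open>a < p\<close> by (auto simp: ks_def is'(2))
  moreover have "distinct ks"
    using is'(1) by (auto simp: ks_def is'(2))
  ultimately have ks: "ks \<noteq> []" "distinct ks" "set ks \<subseteq> {..<p}" "length ks = p"
    using is'(3) by (simp_all add: ks_def)
  have sks: "successively nb ks"
    using is'(3,5) \<open>a < p\<close> by (simp add: ks_def successively_append_iff)
  define ys where "ys = map ((!) xs) ks"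
  have ys: "is_path ys" "length ys = p"
    using is_path_map_nth[OF ks(1-3) sks] ks(4) by (simp_all add: ys_def)
  have hd: "hd ys = xs ! s"
    using is' ks(1) by (simp add: ys_def hd_map ks_def)
  then have "w \<in> set ys"
    using hd_nbr_in_longest_path ys assms(4) by simp
  then obtain j where j: "j < p" "w = ys ! j"
    using ys(2) by (auto simp: set_conv_nth)
  have "ys ! 0 = xs ! s"
    using hd ks(1) by (simp add: hd_conv_nth ys_def)
  then have "j \<le> a"
    using max ys j assms(4) by (auto simp: first_nbrs_le_def)
  moreover have "w = xs ! (ks ! j)"
    using j ks(4) by (simp add: ys_def)
  moreover have "ks ! j \<le> a"
  proof (cases "j < a")
    case True
    then have "ks ! j \<in> set is" by (simp add: ks_def nth_append len)
    then show ?thesis by (simp add: is'(2))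
  next
    case False
    then show ?thesis using \<open>j \<le> a\<close> \<open>a < p\<close> by (simp add: ks_def nth_append len)
  qed
  ultimately show ?thesis by blast
qed

lemma block_start_card:
  assumes max: "first_nbrs_le a"
    and "a < p" "block_start a s" "s < a"
  shows "\<delta> \<le> card {j. nb s j}" and "\<And>j. nb s j \<Longrightarrow> j \<le> a"
proof -
  have *: "\<exists>j\<le>a. w = xs ! j" if "adj (xs ! s) w" for w
    using block_start_nbr[OF max assms(2,3) that] by blast
  then show "\<delta> \<le> card {j. nb s j}"
    using assms(2,4) length_xs by (intro degree_le_index) (force simp: set_conv_nth)+
  show "j \<le> a" if "nb s j" for j
    using *[of "xs ! j"] that assms(2) by (auto simp: nb_def nth_xs_eq)
qed

text \<open>Both \<open>x_0\<close> and \<open>x_{s+1}\<close> start longest paths, so each has at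
  least \<open>\<delta>\<close> neighbours, all with index at most \<open>a\<close>. As
  \<open>2 * \<delta>\<close> exceeds \<open>a + 1\<close>, two of these edges must allow a
  rotation.\<close>

lemma block_start_step:
  assumes max: "first_nbrs_le a"
    and "a < p" "a + 1 < 2 * \<delta>" "block_start a 0" "block_start a (Suc s)" "Suc s < a"
  shows "block_start a s"
proof -
  let ?N = "{j. nb 0 j}" and ?M = "{j. nb (Suc s) j}"
  have N: "\<delta> \<le> card ?N" "\<And>j. nb 0 j \<Longrightarrow> j \<le> a"
    using block_start_card[OF max assms(2,4)] assms(6) by auto
  have M: "\<delta> \<le> card ?M" "\<And>j. nb (Suc s) j \<Longrightarrow> j \<le> a"
    using block_start_card[OF max assms(2,5)] assms(6) by auto
  txt \<open>If none of the three reorderings below applied, \<open>\<phi>\<close> would map the neighbours of \<open>x\<^sub>0\<close>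
    injectively to non-neighbours of \<open>x\<^sub>s\<^sub>+\<^sub>1\<close>.\<close>
  define \<phi> where "\<phi> j = (if j \<le> s then j - 1 else j + 1)" for j :: nat
  have last: "nb (a - Suc 0) a"
    using nb_Suc[of "a - 1"] assms(2,6) by simp
  consider (direct) "nb 0 (Suc s)"
    | (low) i where "i < s" "nb (Suc s) i" "nb 0 (Suc i)"
    | (high) i where "Suc s < i" "nb 0 i" "nb (Suc s) (Suc i)"
  proof (rule ccontr)
    assume "\<not> thesis"
    then have no: "\<not> nb 0 (Suc s)" "\<And>i. i < s \<Longrightarrow> nb (Suc s) i \<Longrightarrow> \<not> nb 0 (Suc i)"
      "\<And>i. Suc s < i \<Longrightarrow> nb 0 i \<Longrightarrow> \<not> nb (Suc s) (Suc i)"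
      using that by blast+
    have pos: "0 < j" if "nb 0 j" for j
      using that by (cases j) auto
    have gt: "Suc s < j" if "nb 0 j" "\<not> j \<le> s" for j
      using that no(1) by (cases "j = Suc s") auto
    have inj: "inj_on \<phi> ?N"
    proof (rule inj_onI)
      fix x y
      assume "x \<in> ?N" "y \<in> ?N" "\<phi> x = \<phi> y"
      then show "x = y" using pos[of x] pos[of y] by (auto simp: \<phi>_def split: if_splits)
    qed
    have disj: "\<phi> ` ?N \<inter> ?M = {}"
    proof -
      have "\<not> nb (Suc s) (\<phi> j)" if "nb 0 j" for j
      proof (cases "j \<le> s")
        case True
        then have "j - 1 < s" "Suc (j - 1) = j" using pos[OF that] by auto
        then show ?thesis using no(2)[of "j - 1"] True that by (auto simp: \<phi>_def)
      next
        case False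
        then show ?thesis using no(3)[of j] gt[OF that] that by (auto simp: \<phi>_def)
      qed
      then show ?thesis by auto
    qed
    \<comment> \<open>Without \<open>s + 1\<close> the range has \<open>a + 1\<close> elements, too
      few for two disjoint sets of size at least \<open>\<delta>\<close>.\<close>
    have sub: "\<phi> ` ?N \<union> ?M \<subseteq> {..a + 1} - {Suc s}"
    proof -
      have "\<phi> j \<le> a + 1 \<and> \<phi> j \<noteq> Suc s" if "nb 0 j" for j
        using gt[OF that] N(2)[OF that] by (auto simp: \<phi>_def)
      moreover have "j \<le> a + 1 \<and> j \<noteq> Suc s" if "nb (Suc s) j" for j
        using M(2)[OF that] that by (cases "j = Suc s") auto
      ultimately show ?thesis by auto
    qed
    have "card (\<phi> ` ?N \<union> ?M) = card ?N + card ?M"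
      using disj inj finite_nb by (simp add: card_Un_disjoint card_image)
    moreover have "card (\<phi> ` ?N \<union> ?M) \<le> card ({..a + 1} - {Suc s})"
      by (rule card_mono[OF _ sub]) simp
    moreover have "card ({..a + 1} - {Suc s}) = a + 1"
      using assms(6) by (simp add: card_Diff_singleton)
    ultimately show False using N(1) M(1) assms(3) by simp
  qed
  \<comment> \<open>The reorderings, followed by \<open>a\<close>, visit in turn:
    \<open>s..0, s+1..a\<close>; \<open>s..i+1, 0..i, s+1..a\<close>;
    \<open>s..0, i..s+1, i+1..a\<close>.\<close>
  then show ?thesis
  proof cases
    case direct
    show ?thesis unfolding block_start_def
      by (rule exI[of _ "rev [0..<Suc s] @ [Suc s..<a]"])
        (use direct assms(2,6) last in \<open>auto simp: successively_append_iff hd_append hd_rev last_rev nb_Suc simp del: upt_Suc\<close>)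
  next
    case low
    then have "nb i (Suc s)" "nb (Suc i) 0" by (simp_all add: nb_sym)
    show ?thesis unfolding block_start_def
      by (rule exI[of _ "rev [Suc i..<Suc s] @ [0..<Suc i] @ [Suc s..<a]"])
        (use low assms(2,6) last \<open>nb i (Suc s)\<close> \<open>nb (Suc i) 0\<close> in \<open>auto simp: successively_append_iff hd_append hd_rev last_rev nb_Suc simp del: upt_Suc\<close>)
  next
    case high
    then have "Suc i \<le> a" using M(2) by auto
    show ?thesis unfolding block_start_def
      by (rule exI[of _ "rev [0..<Suc s] @ rev [Suc s..<Suc i] @ [Suc i..<a]"])
        (use high assms(2,6) last \<open>Suc i \<le> a\<close> in \<open>auto simp: successively_append_iff hd_append hd_rev last_rev nb_Suc simp del: upt_Suc\<close>)
  qed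
qed

lemma first_nbr_index_ge:
  assumes max: "first_nbrs_le a" and a: "nb 0 a" "a + 1 < p"
  shows "2 * \<delta> \<le> a + 1"
proof (rule ccontr)
  assume "\<not> ?thesis"
  then have lt: "a + 1 < 2 * \<delta>" by simp
  have "0 < a" using a(1) by (cases a) auto
  have "nb (a - Suc 0) a"
    using nb_Suc[of "a - 1"] a(2) \<open>0 < a\<close> by simp
  then have zero: "block_start a 0"
    unfolding block_start_def using \<open>0 < a\<close> a
    by (intro exI[of _ "[0..<a]"]) (auto simp: successively_append_iff)
  have last: "block_start a (a - 1)"
    unfolding block_start_def using \<open>0 < a\<close> a
    by (intro exI[of _ "rev [0..<a]"])
      (auto simp: successively_append_iff hd_rev last_rev)
  have all: "block_start a s" if "s < a" for s
  proof -
    have "s \<le> a - 1" using that by simp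
    then show ?thesis
    proof (induction rule: inc_induct)
      case base
      then show ?case using last .
    next
      case (step n)
      then show ?case
        using block_start_step[OF max _ lt zero] a(2) by simp
    qed
  qed
  \<comment> \<open>Edges leave this set only to \<open>x_a\<close>, while \<open>a + 1 < p\<close>
    puts the last vertex on the other side.\<close>
  let ?X = "(!) xs ` {..<a}"
  have "xs ! (p - 1) \<notin> ?X" "xs ! (p - 1) \<noteq> xs ! a" "xs ! a \<notin> ?X"
    using a(2) by (auto simp: nth_xs_eq)
  moreover have "?X \<subseteq> V" "xs ! (p - 1) \<in> V" "xs ! a \<in> V"
    using a(2) nth_xs_in_V by auto
  moreover have "?X \<noteq> {}" using \<open>0 < a\<close> by auto
  ultimately obtain x y where xy: "x \<in> ?X" "y \<in> V - {xs ! a} - ?X" "adj x y"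
    using no_cut_vertex[of "xs ! a" ?X] by blast
  then obtain s where s: "s < a" "x = xs ! s" by auto
  then obtain j where "j \<le> a" "y = xs ! j"
    using block_start_nbr[OF max _ all] a(2) xy(3) by (metis add_lessD1)
  then show False using xy(2) by (cases "j = a") auto
qed

lemma first_index_cycle:
  assumes "nb 0 a" "2 \<le> a"
  shows "a + 1 \<le> c"
proof -
  have "{0..<Suc a} \<subseteq> {..<p}" using nb_less[OF assms(1)] by auto
  then show ?thesis
    using index_cycle_le[of "[0..<Suc a]"] assms nb_less[OF assms(1)] nb_sym[of 0 a]
    by (simp del: upt_Suc)
qed

end

lemma (in two_connected_graph) obtain_first_nbrs_le:
  assumes "is_path zs" "length zs = p"
  obtains xs a where "is_path xs" "length xs = p" "first_nbrs_le a" "a < p" "adj (xs ! 0) (xs ! a)"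
proof -
  define S where "S = {j. \<exists>ys. is_path ys \<and> length ys = p \<and> j < p \<and> adj (ys ! 0) (ys ! j)}"
  have fin: "finite S"
    by (rule finite_subset[of _ "{..<p}"]) (auto simp: S_def)
  interpret Z: longest_path V adj \<delta> p c zs
    using assms by unfold_locales
  have "{j. Z.nb 0 j} \<noteq> {}"
    using Z.degree_first two_le_degree by (intro notI) simp
  then have ne: "S \<noteq> {}"
    using assms by (auto simp: S_def Z.nb_def)
  have "Max S \<in> S" using fin ne by simp
  then obtain xs where "is_path xs" "length xs = p" "Max S < p" "adj (xs ! 0) (xs ! Max S)"
    by (auto simp: S_def)
  moreover have "first_nbrs_le (Max S)"
    unfolding first_nbrs_le_def using fin by (auto intro!: Max_ge simp: S_def)
  ultimately show thesis using that by blast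
qed

context longest_path
begin

lemma degree_le_first_nbr_bound:
  assumes "\<And>j. nb 0 j \<Longrightarrow> j \<le> a"
  shows "\<delta> \<le> a"
proof -
  have "{j. nb 0 j} \<subseteq> {1..a}"
  proof
    fix j assume "j \<in> {j. nb 0 j}"
    then show "j \<in> {1..a}" using assms[of j] by (cases j) auto
  qed
  then have "card {j. nb 0 j} \<le> card {1..a}" by (rule card_mono[rotated]) simp
  then show ?thesis using degree_first by simp
qed

end

lemma (in two_connected_graph) dirac_bound:
  assumes "is_path zs" "length zs = p"
  shows "min p (2 * \<delta>) \<le> c"
proof -
  obtain xs a where xs: "is_path xs" "length xs = p" "first_nbrs_le a" "a < p" "adj (xs ! 0) (xs ! a)"
    using obtain_first_nbrs_le[OF assms] .
  interpret X: longest_path V adj \<delta> p c xs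
    using xs by unfold_locales
  have a: "X.nb 0 a" using xs by (auto simp: X.nb_def)
  have "j \<le> a" if "X.nb 0 j" for j
    using that xs by (auto simp: X.nb_def first_nbrs_le_def)
  then have "\<delta> \<le> a" by (rule X.degree_le_first_nbr_bound)
  then have "a + 1 \<le> c" using X.first_index_cycle a two_le_degree by simp
  moreover have "a + 1 = p \<or> 2 * \<delta> \<le> a + 1"
    using X.first_nbr_index_ge[OF xs(3) a] xs(4) by linarith
  ultimately show ?thesis by auto
qed

section \<open>Cycles with an ear\<close>

text \<open>\<open>A\<close> and \<open>B\<close> are the positions, on a cycle of length
  \<open>n\<close>, of the neighbours of the two ends of an ear with \<open>m\<close> vertices. All
  gaps between consecutive elements of \<open>S\<close> are at least 2, those at elements of
  \<open>T\<close> at least \<open>m + 1\<close>, and together they are at most \<open>n\<close>. It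
  remains to see that \<open>T\<close> is large.\<close>

lemma cyclic_gap_count:
  fixes n m d :: nat and A B :: "nat set"
  assumes AB: "A \<subseteq> {..<n}" "B \<subseteq> {..<n}" "0 \<in> A"
    and ne: "\<exists>a\<in>A. \<exists>b\<in>B. a \<noteq> b"
    and mixed: "\<And>i j. i < j \<Longrightarrow> i \<in> A \<and> j \<in> B \<or> i \<in> B \<and> j \<in> A
      \<Longrightarrow> m + 1 \<le> j - i \<and> m + 1 + (j - i) \<le> n"
    and same: "\<And>i j. i < j \<Longrightarrow> i \<in> A \<and> j \<in> A \<or> i \<in> B \<and> j \<in> B
      \<Longrightarrow> 2 \<le> j - i \<and> 2 + (j - i) \<le> n"
    and m: "2 \<le> m" and dA: "d + 1 \<le> card A + m" and dB: "d + 1 \<le> card B + m"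
  shows "3 * d \<le> n + m + 1"
proof -
  define S where "S = A \<union> B"
  \<comment> \<open>For the largest element the default \<open>n\<close> stands for position 0 one
    turn later, which is occupied because \<open>0 \<in> A\<close>.\<close>
  define nxt where "nxt y = Min (insert n {z \<in> S. y < z})" for y
  define T where "T = {y \<in> S. m + 1 \<le> nxt y - y}"
  have fin: "finite A" "finite B" "finite S" "finite T"
    using AB finite_subset unfolding S_def T_def by (auto intro: finite_subset)
  have nxt_in: "nxt y \<in> insert n {z \<in> S. y < z}" for y
    unfolding nxt_def by (rule Min_in) (use fin in auto)
  have nxt_le: "nxt y \<le> z" if "z \<in> S" "y < z" for y z
    unfolding nxt_def by (rule Min_le) (use fin that in auto)
  have S_lt: "y < n" if "y \<in> S" for y
    using that AB by (auto simp: S_def)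
  have nxt_gt: "y < nxt y" if "y \<in> S" for y
    using nxt_in[of y] S_lt[OF that] by auto
  have nxt_n: "nxt y \<le> n" for y
    unfolding nxt_def using fin by simp
  have last: "0 < y" if "y \<in> S" "nxt y = n" for y
  proof (rule ccontr)
    assume "\<not> 0 < y"
    moreover obtain z where "z \<in> S" "0 < z" using ne by (auto simp: S_def)
    ultimately show False using nxt_le[of z y] S_lt[of z] that by simp
  qed
  have gap2: "2 \<le> nxt y - y" if y: "y \<in> S" for y
  proof (cases "nxt y = n")
    case True
    then show ?thesis
      using mixed[of 0 y] same[of 0 y] last[OF y True] y AB(3) m by (auto simp: S_def)
  next
    case False
    then have "nxt y \<in> S" "y < nxt y" using nxt_in[of y] by auto
    then show ?thesis
      using mixed[of y "nxt y"] same[of y "nxt y"] y m unfolding S_def by fastforce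
  qed
  have T_wrap: "y \<in> T" if "y \<in> B" "nxt y = n" for y
    using mixed[of 0 y] last[of y] that AB(3) by (auto simp: T_def S_def)
  have T_wrap': "y \<in> T" if "y \<in> S" "nxt y = n" "0 \<in> B" "y \<in> A" for y
    using mixed[of 0 y] last[of y] that by (auto simp: T_def S_def)
  have T_mixed: "y \<in> T" if "nxt y \<noteq> n" "y \<in> A \<and> nxt y \<in> B \<or> y \<in> B \<and> nxt y \<in> A" for y
    using mixed[of y "nxt y"] nxt_gt[of y] that unfolding T_def S_def by blast
  have AB_T: "A \<inter> B \<subseteq> T"
  proof
    fix y assume y: "y \<in> A \<inter> B"
    show "y \<in> T"
    proof (cases "nxt y = n")
      case True
      then show ?thesis using T_wrap y by blast
    next
      case False
      then have "nxt y \<in> S" using nxt_in[of y] by auto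
      then show ?thesis using T_mixed[OF False] y by (auto simp: S_def)
    qed
  qed
  \<comment> \<open>Around the cycle there is a step from \<open>A\<close> to \<open>B\<close> and
    another one from \<open>B\<close> to \<open>A\<close>. If \<open>B = {0}\<close>, these are the
    steps into and out of 0.\<close>
  have card_T: "2 \<le> card T"
  proof -
    have "\<exists>y\<in>T. \<exists>y'\<in>T. y \<noteq> y'"
    proof (cases "\<exists>b\<in>B. b \<noteq> 0")
      case True
      then obtain b where b: "b \<in> B" "0 < b" by auto
      define y where "y = Max {y \<in> A. y < b}"
      have "y \<in> {y \<in> A. y < b}"
        unfolding y_def by (rule Max_in) (use fin AB b in auto)
      then have y: "y \<in> A" "y < b" by auto
      have nle: "nxt y \<le> b" using nxt_le[of b y] y b by (auto simp: S_def)
      then have nn: "nxt y \<noteq> n" using S_lt[of b] b by (auto simp: S_def)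
      then have ns: "nxt y \<in> S" "y < nxt y" using nxt_in[of y] by auto
      have "nxt y \<in> B"
      proof (rule ccontr)
        assume "nxt y \<notin> B"
        then have "nxt y \<in> {y \<in> A. y < b}" using ns nle b by (auto simp: S_def le_less)
        then have "nxt y \<le> y" unfolding y_def by (intro Max_ge) (use fin in auto)
        then show False using ns by simp
      qed
      then have yT: "y \<in> T" using T_mixed nn y by blast
      define y' where "y' = Max B"
      have y': "y' \<in> B" "b \<le> y'" using fin b by (auto simp: y'_def intro: Max_in)
      have "y' \<in> T"
      proof (cases "nxt y' = n")
        case True
        then show ?thesis using T_wrap y' by blast
      next
        case False
        then have "nxt y' \<in> S" "y' < nxt y'" using nxt_in[of y'] by auto
        moreover have "nxt y' \<notin> B"
          using fin(2) \<open>y' < nxt y'\<close> Max_ge[of B "nxt y'"] unfolding y'_def by linarith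
        ultimately show ?thesis using T_mixed[OF False] y' by (auto simp: S_def)
      qed
      then show ?thesis using yT y y' by (metis leD)
    next
      case False
      then have B: "0 \<in> B" "B \<subseteq> {0}" using ne by auto
      then obtain a where a: "a \<in> A" "0 < a" using ne by auto
      define y where "y = Max A"
      have y: "y \<in> A" "a \<le> y" using fin a by (auto simp: y_def intro: Max_in)
      have "nxt y = n"
      proof (rule ccontr)
        assume "nxt y \<noteq> n"
        then have "nxt y \<in> S" "y < nxt y" using nxt_in[of y] by auto
        then have "nxt y \<in> A" using B a y by (auto simp: S_def)
        then show False using \<open>y < nxt y\<close> fin(1) Max_ge[of A "nxt y"] unfolding y_def by linarith
      qed
      then have "y \<in> T" using T_wrap' y B by (auto simp: S_def)
      moreover have "0 \<in> T" using AB_T AB B by auto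
      ultimately show ?thesis using a y by (intro bexI[of _ 0] bexI[of _ y]) auto
    qed
    then obtain y y' where "{y, y'} \<subseteq> T" "y \<noteq> y'" by auto
    then show ?thesis using card_mono[OF fin(4), of "{y, y'}"] by simp
  qed
  have "(\<Sum>y\<in>S. card {y..<nxt y}) = card (\<Union>y\<in>S. {y..<nxt y})"
  proof (rule card_UN_disjoint[symmetric])
    show "\<forall>y\<in>S. \<forall>z\<in>S. y \<noteq> z \<longrightarrow> {y..<nxt y} \<inter> {z..<nxt z} = {}"
    proof (intro ballI impI)
      fix y z assume "y \<in> S" "z \<in> S" "y \<noteq> z"
      then show "{y..<nxt y} \<inter> {z..<nxt z} = {}"
        using nxt_le[of z y] nxt_le[of y z] by (cases "y < z") auto
    qed
  qed (use fin in auto)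
  also have "\<dots> \<le> card {..<n}"
    by (rule card_mono) (use nxt_n in \<open>auto intro: less_le_trans\<close>)
  finally have sum_le: "(\<Sum>y\<in>S. nxt y - y) \<le> n" by simp
  have "(\<Sum>y\<in>S. 2 + (if y \<in> T then m - 1 else 0)) \<le> (\<Sum>y\<in>S. nxt y - y)"
  proof (rule sum_mono)
    fix y assume "y \<in> S"
    then show "2 + (if y \<in> T then m - 1 else 0) \<le> nxt y - y"
      using gap2[of y] m by (simp add: T_def)
  qed
  moreover have "(\<Sum>y\<in>S. 2 + (if y \<in> T then m - 1 else 0)) = 2 * card S + card T * (m - 1)"
  proof -
    have "S \<inter> T = T" by (auto simp: T_def)
    then show ?thesis using fin by (simp only: sum.distrib sum.If_cases) simp
  qed
  ultimately have main: "2 * card S + card T * (m - 1) \<le> n" using sum_le by simp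
  obtain k where k: "m = k + 2" using m by (metis add.commute le_Suc_ex)
  \<comment> \<open>\<open>2 \<le> card T\<close> yields the term \<open>2 * k\<close>; what
    remains, \<open>2 * card S + card T\<close>, is at least
    \<open>2 * card A + card B\<close>.\<close>
  have "card T + 2 * k \<le> card T * (m - 1)"
    using card_T k by (simp add: mult_le_mono1)
  moreover have "card (A \<inter> B) \<le> card T" using card_mono[OF fin(4) AB_T] .
  moreover have "card S + card (A \<inter> B) = card A + card B"
    using card_Un_Int[OF fin(1,2)] by (simp add: S_def)
  moreover have "card A \<le> card S" using card_mono[OF fin(3), of A] by (simp add: S_def)
  ultimately show ?thesis using main dA dB k by linarith
qed

section \<open>Exchange arguments on a longest cycle with an ear\<close>

context two_connected_graph
begin

text \<open>
  Whenever \<open>C\<close> and \<open>Q\<close> are as follows, going around \<open>C\<close> and then along \<open>Q\<close> gives a longest path that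
  ends in \<open>hd Q\<close>, so the neighbours of \<open>hd Q\<close> (and likewise of \<open>last Q\<close>) lie on \<open>C\<close> and \<open>Q\<close>.
\<close>

definition cycle_with_ear :: "'a list \<Rightarrow> 'a list \<Rightarrow> bool" where
  "cycle_with_ear C Q \<longleftrightarrow> is_cycle C \<and> is_path Q \<and> set C \<inter> set Q = {} \<and> length C + length Q = p \<and>
     (\<exists>y\<in>set C. \<exists>z\<in>set C. y \<noteq> z \<and> adj (hd Q) y \<and> adj (last Q) z)"

lemma cycle_with_ear_rev: "cycle_with_ear C Q \<Longrightarrow> cycle_with_ear C (rev Q)"
  unfolding cycle_with_ear_def hd_rev last_rev is_path_rev set_rev length_rev by metis

definition max_cycle_with_ear :: "'a list \<Rightarrow> 'a list \<Rightarrow> bool" where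
  "max_cycle_with_ear C Q \<longleftrightarrow>
     cycle_with_ear C Q \<and> (\<forall>C' Q'. cycle_with_ear C' Q' \<longrightarrow> length C' \<le> length C)"

lemma ear_hd_nbr:
  assumes "cycle_with_ear C Q" "adj (hd Q) w"
  shows "w \<in> set C \<union> set Q"
proof -
  obtain z where z: "z \<in> set C" "adj (last Q) z"
    using assms(1) by (auto simp: cycle_with_ear_def)
  have C: "is_cycle C" "is_path Q" "set C \<inter> set Q = {}" "length C + length Q = p"
    using assms(1) by (auto simp: cycle_with_ear_def)
  obtain r where r: "is_cycle (z # r)" "set (z # r) = set C" "length (z # r) = length C"
    using is_cycle_split[OF C(1) z(1)] .
  have "is_path (Q @ z # r)"
    using r(1) C(2,3) z(2) r(2)[symmetric]
    by (auto simp: is_cycle_def is_path_def successively_append_iff)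
  moreover have "hd (Q @ z # r) = hd Q" using C(2) by (simp add: is_path_def)
  ultimately show ?thesis
    using hd_nbr_in_longest_path[of "Q @ z # r" w] assms(2) r(2,3) C(4) by auto
qed

lemma is_cycle_split_nth:
  assumes "is_cycle C" "i < j" "j < length C"
  obtains g h where "is_cycle (C ! i # g @ C ! j # h)" "is_cycle (C ! j # h @ C ! i # g)"
    "set (C ! i # g @ C ! j # h) = set C"
    "length g = j - i - 1" "length h = length C - (j - i) - 1"
proof -
  define g where "g = drop (Suc i) (take j C)"
  define h where "h = drop (Suc j) C @ take i C"
  have C: "C = take i C @ C ! i # g @ C ! j # drop (Suc j) C"
  proof -
    have "take j C = take i C @ C ! i # g"
      using id_take_nth_drop[of i "take j C"] assms by (simp add: g_def min_def)
    then show ?thesis using id_take_nth_drop[of j C] assms by simp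
  qed
  have c1: "is_cycle (C ! i # g @ C ! j # h)"
    using is_cycle_rotate[of "take i C" "C ! i # g @ C ! j # drop (Suc j) C"] C assms(1)
    by (simp add: h_def)
  moreover have "is_cycle (C ! j # h @ C ! i # g)"
    using is_cycle_rotate[of "C ! i # g" "C ! j # h"] c1 by simp
  moreover have "set (C ! i # g @ C ! j # h) = set C"
    using arg_cong[OF C, of set] by (auto simp: h_def)
  moreover have "length g = j - i - 1" "length h = length C - (j - i) - 1"
    using assms by (auto simp: g_def h_def)
  ultimately show thesis using that by blast
qed

text \<open>If \<open>g\<close> were shorter than \<open>Q\<close>, exchanging them would give a
  longer cycle with ear \<open>g\<close>, or a cycle with \<open>p > c\<close> vertices if
  \<open>g\<close> is empty.\<close>

lemma ear_gap:
  assumes ear: "max_cycle_with_ear C Q"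
    and "c < p"
    and cyc: "is_cycle (a # g @ b # r)" "set (a # g @ b # r) = set C"
    and "adj (hd Q) a" "adj (last Q) b"
  shows "length Q \<le> length g"
proof (rule ccontr)
  assume lt: "\<not> ?thesis"
  have Q: "is_path Q" "set C \<inter> set Q = {}" "length C + length Q = p" "is_cycle C"
    using ear by (auto simp: cycle_with_ear_def max_cycle_with_ear_def)
  have len: "length (a # g @ b # r) = length C"
    using distinct_card[of "a # g @ b # r"] distinct_card[of C] cyc Q(4)
    by (metis is_cycle_def is_path_def)
  have disj: "set (a # g @ b # r) \<inter> set Q = {}" using Q(2) cyc(2) by simp
  let ?C = "a # Q @ b # r"
  have C': "is_cycle ?C"
    using cyc(1) Q(1) disj assms(5,6) adj_sym[OF assms(5)]
    by (cases Q) (auto simp: is_cycle_def is_path_def successively_append_iff successively_Cons hd_append)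
  show False
  proof (cases "g = []")
    case True
    then show False using cycle_length_le[OF C'] len Q(3) assms(2) by simp
  next
    case False
    have "is_path g" "adj a (hd g)" "adj (last g) b" "a \<noteq> b" "set ?C \<inter> set g = {}"
      using cyc(1) False disj
      by (auto simp: is_cycle_def is_path_def successively_append_iff successively_Cons)
    moreover have "adj (hd g) a" using adj_sym \<open>adj a (hd g)\<close> by blast
    ultimately have "cycle_with_ear ?C g"
      using C' len Q(3) unfolding cycle_with_ear_def by auto
    then show False using ear len lt by (fastforce simp: max_cycle_with_ear_def)
  qed
qed

text \<open>Inserting \<open>hd Q\<close> between \<open>a\<close> and \<open>b\<close> lengthens
  the cycle. The rest of \<open>Q\<close>, nonempty by \<open>2 \<le> length Q\<close>, is an ear
  attached to \<open>hd Q\<close> and to \<open>z\<close>.\<close>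

lemma ear_no_adjacent_nbrs:
  assumes ear: "max_cycle_with_ear C Q"
    and "2 \<le> length Q"
    and cyc: "is_cycle (a # b # r)" "set (a # b # r) = set C"
    and "adj (hd Q) a" "adj (hd Q) b"
  shows False
proof -
  obtain q q' Q' where Q': "Q = q # q' # Q'"
    using assms(2) by (cases Q; cases "tl Q") auto
  have Q: "is_path Q" "set C \<inter> set Q = {}" "length C + length Q = p" "is_cycle C"
    using ear by (auto simp: cycle_with_ear_def max_cycle_with_ear_def)
  obtain z where z: "z \<in> set C" "adj (last Q) z"
    using ear by (auto simp: cycle_with_ear_def max_cycle_with_ear_def)
  have len: "length (a # b # r) = length C"
    using distinct_card[of "a # b # r"] distinct_card[of C] cyc Q(4)
    by (metis is_cycle_def is_path_def)
  have disj: "set (a # b # r) \<inter> set Q = {}" using Q(2) cyc(2) by simp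
  let ?C = "a # q # b # r"
  have C': "is_cycle ?C"
    using cyc(1) Q(1) disj assms(5,6) adj_sym[OF assms(5)] adj_V[OF assms(5)] Q'
    by (auto simp: is_cycle_def is_path_def)
  have "is_path (q' # Q')" "adj q q'" "q \<noteq> z" "set ?C \<inter> set (q' # Q') = {}"
    using Q(1,2) Q' z disj by (auto simp: is_path_def)
  moreover have "adj q' q" using adj_sym \<open>adj q q'\<close> by blast
  moreover have "z \<in> set ?C" "adj (last (q' # Q')) z" using z cyc(2)[symmetric] Q' by auto
  ultimately have "cycle_with_ear ?C (q' # Q')"
    using C' len Q(3) Q' unfolding cycle_with_ear_def by auto
  then show False using ear len by (fastforce simp: max_cycle_with_ear_def)
qed

lemma ear_degree:
  assumes "cycle_with_ear C Q"
  shows "\<delta> + 1 \<le> card {i. i < length C \<and> adj (hd Q) (C ! i)} + length Q"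
proof -
  let ?A = "{i. i < length C \<and> adj (hd Q) (C ! i)}"
  have Q: "is_path Q" using assms by (auto simp: cycle_with_ear_def)
  then have hd: "hd Q \<in> set Q" by (simp add: is_path_def)
  have sub: "{w. adj (hd Q) w} \<subseteq> (!) C ` ?A \<union> (set Q - {hd Q})"
  proof
    fix w assume w: "w \<in> {w. adj (hd Q) w}"
    then have "w \<in> set C \<union> set Q" using ear_hd_nbr[OF assms] by simp
    then show "w \<in> (!) C ` ?A \<union> (set Q - {hd Q})"
      using w adj_irrefl by (auto simp: in_set_conv_nth)
  qed
  have "\<delta> \<le> card {w. adj (hd Q) w}"
    using Q hd by (intro degree_ge) (auto simp: is_path_def)
  also have "\<dots> \<le> card ((!) C ` ?A \<union> (set Q - {hd Q}))"
    by (rule card_mono[OF _ sub]) simp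
  also have "\<dots> \<le> card ((!) C ` ?A) + card (set Q - {hd Q})"
    by (rule card_Un_le)
  also have "card ((!) C ` ?A) \<le> card ?A"
    by (rule card_image_le) simp
  also have "card (set Q - {hd Q}) = length Q - 1"
    using Q hd by (simp add: is_path_def distinct_card)
  finally have "\<delta> \<le> card ?A + (length Q - 1)" by simp
  then show ?thesis using Q by (cases Q) (auto simp: is_path_def)
qed

lemma ear_degree_bound:
  assumes "cycle_with_ear C\<^sub>0 Q\<^sub>0" "c + 2 \<le> p"
  shows "3 * \<delta> \<le> p + 1"
proof -
  let ?P = "\<lambda>n. \<exists>C Q. cycle_with_ear C Q \<and> length C = n"
  have "?P (length C\<^sub>0)" using assms by blast
  moreover have "k \<le> p" if "?P k" for k using that by (auto simp: cycle_with_ear_def)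
  ultimately have "\<exists>n. ?P n \<and> (\<forall>k. ?P k \<longrightarrow> k \<le> n)"
    using Nat.ex_has_greatest_nat[of ?P "length C\<^sub>0" p] by blast
  then obtain C Q where CQ: "cycle_with_ear C Q"
    and mx: "\<And>C' Q'. cycle_with_ear C' Q' \<Longrightarrow> length C' \<le> length C"
    by blast
  obtain y where y: "y \<in> set C" "adj (hd Q) y" using CQ by (auto simp: cycle_with_ear_def)
  \<comment> \<open>Rotate the cycle so that position 0 is a neighbour of \<open>hd Q\<close>, as
    \<open>cyclic_gap_count\<close> requires.\<close>
  obtain r where r: "is_cycle (y # r)" "set (y # r) = set C" "length (y # r) = length C"
    using is_cycle_split[of C y] CQ y(1) by (auto simp: cycle_with_ear_def)
  define D where "D = y # r"
  have ear: "cycle_with_ear D Q" using CQ r by (auto simp: cycle_with_ear_def D_def)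
  have mear: "max_cycle_with_ear D Q"
    using ear mx r(3) by (auto simp: max_cycle_with_ear_def D_def)
  have ear': "cycle_with_ear D (rev Q)" using cycle_with_ear_rev[OF ear] .
  have mear': "max_cycle_with_ear D (rev Q)" using mear ear' by (auto simp: max_cycle_with_ear_def)
  have D: "is_cycle D" "length D + length Q = p" using ear by (auto simp: cycle_with_ear_def)
  have m: "2 \<le> length Q" using cycle_length_le[OF D(1)] D(2) assms(2) by simp
  then have m': "2 \<le> length (rev Q)" by simp
  have "c < p" using assms(2) by simp
  define A where "A = {i. i < length D \<and> adj (hd Q) (D ! i)}"
  define B where "B = {i. i < length D \<and> adj (last Q) (D ! i)}"
  have mixed: "length Q + 1 \<le> j - i \<and> length Q + 1 + (j - i) \<le> length D"
    if ij: "i < j" "i \<in> A \<and> j \<in> B \<or> i \<in> B \<and> j \<in> A" for i j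
  proof -
    have j: "j < length D" using ij by (auto simp: A_def B_def)
    obtain g h where gh: "is_cycle (D ! i # g @ D ! j # h)" "is_cycle (D ! j # h @ D ! i # g)"
      "set (D ! i # g @ D ! j # h) = set D"
      "length g = j - i - 1" "length h = length D - (j - i) - 1"
      using is_cycle_split_nth[OF D(1) ij(1) j] .
    have set': "set (D ! j # h @ D ! i # g) = set D" using gh(3) by auto
    note 1 = ear_gap[OF mear \<open>c < p\<close> gh(1,3)] ear_gap[OF mear \<open>c < p\<close> gh(2) set']
    note 2 = ear_gap[OF mear' \<open>c < p\<close> gh(1,3)] ear_gap[OF mear' \<open>c < p\<close> gh(2) set']
    have "length Q \<le> length g \<and> length Q \<le> length h"
      using ij 1 2 by (auto simp: A_def B_def hd_rev last_rev)
    then show ?thesis using gh(4,5) m by linarith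
  qed
  have same: "2 \<le> j - i \<and> 2 + (j - i) \<le> length D"
    if ij: "i < j" "i \<in> A \<and> j \<in> A \<or> i \<in> B \<and> j \<in> B" for i j
  proof -
    have j: "j < length D" using ij by (auto simp: A_def B_def)
    obtain g h where gh: "is_cycle (D ! i # g @ D ! j # h)" "is_cycle (D ! j # h @ D ! i # g)"
      "set (D ! i # g @ D ! j # h) = set D"
      "length g = j - i - 1" "length h = length D - (j - i) - 1"
      using is_cycle_split_nth[OF D(1) ij(1) j] .
    have set': "set (D ! j # h @ D ! i # g) = set D" using gh(3) by auto
    have nadj: "adj (hd Q) (D ! i) \<and> adj (hd Q) (D ! j) \<or> adj (last Q) (D ! i) \<and> adj (last Q) (D ! j)"
      using ij by (auto simp: A_def B_def)
    have "g \<noteq> []"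
      using ear_no_adjacent_nbrs[OF mear m, of "D ! i" "D ! j" h]
        ear_no_adjacent_nbrs[OF mear' m', of "D ! i" "D ! j" h] gh(1,3) nadj
      by (auto simp: hd_rev)
    moreover have "h \<noteq> []"
      using ear_no_adjacent_nbrs[OF mear m, of "D ! j" "D ! i" g]
        ear_no_adjacent_nbrs[OF mear' m', of "D ! j" "D ! i" g] gh(2) set' nadj
      by (auto simp: hd_rev)
    ultimately have "0 < length g" "0 < length h" by auto
    then show ?thesis using gh(4,5) by linarith
  qed
  have sub: "A \<subseteq> {..<length D}" "B \<subseteq> {..<length D}" "0 \<in> A"
    using y by (auto simp: A_def B_def D_def)
  have "\<exists>y\<in>set D. \<exists>z\<in>set D. y \<noteq> z \<and> adj (hd Q) y \<and> adj (last Q) z"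
    using ear unfolding cycle_with_ear_def by (elim conjE)
  then obtain u v where uv: "u \<in> set D" "v \<in> set D" "u \<noteq> v" "adj (hd Q) u" "adj (last Q) v"
    by (elim bexE conjE)
  obtain k l where kl: "k < length D" "D ! k = u" "l < length D" "D ! l = v"
    using uv(1,2) by (metis in_set_conv_nth)
  then have "k \<in> A" "l \<in> B" "k \<noteq> l"
    using uv(3-5) by (auto simp: A_def B_def)
  then have ne: "\<exists>a\<in>A. \<exists>b\<in>B. a \<noteq> b" by blast
  have deg: "\<delta> + 1 \<le> card A + length Q" "\<delta> + 1 \<le> card B + length Q"
    using ear_degree[OF ear] ear_degree[OF ear'] by (simp_all add: A_def B_def hd_rev)
  have "3 * \<delta> \<le> length D + length Q + 1"
    by (rule cyclic_gap_count[OF sub ne]) (use mixed same m deg in \<open>blast+\<close>)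
  then show ?thesis using D(2) by simp
qed

end

section \<open>Combining both ends of the path\<close>

context longest_path
begin

text \<open>If the edges at the two ends cross, this cycle misses only the vertices strictly between
  \<open>x_b\<close> and \<open>x_a\<close>.\<close>

lemma crossing_cycle:
  assumes "nb 0 a" "nb b (p - 1)" "0 < b" "b < a" "a + 1 < p"
  shows "is_cycle (map ((!) xs) ([0..<Suc b] @ rev [a..<p]))"
proof (rule is_cycle_map_nth)
  show "nb (last ([0..<Suc b] @ rev [a..<p])) (hd ([0..<Suc b] @ rev [a..<p]))"
    using assms nb_sym[of 0 a] by (simp add: last_rev del: upt_Suc)
qed (use assms in \<open>auto simp: successively_append_iff hd_rev simp del: upt_Suc\<close>)

lemma degree_last_nbr_bound:
  assumes "\<And>j. nb (p - 1) j \<Longrightarrow> b \<le> j"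
  shows "\<delta> + b + 1 \<le> p"
proof -
  have sub: "{j. nb (p - 1) j} \<subseteq> {b..<p - 1}"
  proof
    fix j assume j: "j \<in> {j. nb (p - 1) j}"
    then have "j < p" "j \<noteq> p - 1" by (auto simp: nb_def adj_irrefl)
    then show "j \<in> {b..<p - 1}" using assms j by simp
  qed
  have "\<delta> \<le> p - 1 - b" using card_mono[OF _ sub] degree_last by simp
  then show ?thesis using two_le_degree by linarith
qed

end

lemma (in two_connected_graph) relative_length_bound:
  assumes "is_path zs" "length zs = p" "c + 2 \<le> p"
  shows "3 * \<delta> \<le> p + 1"
proof -
  obtain xs a where xs: "is_path xs" "length xs = p" "first_nbrs_le a" "a < p" "adj (xs ! 0) (xs ! a)"
    using obtain_first_nbrs_le[OF assms(1,2)] .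
  interpret X: longest_path V adj \<delta> p c xs
    using xs by unfold_locales
  have a: "X.nb 0 a" using xs by (auto simp: X.nb_def)
  have a_max: "j \<le> a" if "X.nb 0 j" for j
    using that xs by (auto simp: X.nb_def first_nbrs_le_def)
  then have "\<delta> \<le> a" by (rule X.degree_le_first_nbr_bound)
  then have "a + 1 \<le> c" using X.first_index_cycle a two_le_degree by simp
  then have ap: "a + 1 < p" using assms(3) by simp
  have a2: "2 * \<delta> \<le> a + 1" using X.first_nbr_index_ge[OF xs(3) a ap] .
  define b where "b = Min {j. X.nb (p - 1) j}"
  have b_le: "b \<le> j" if "X.nb (p - 1) j" for j
    unfolding b_def using that X.finite_nb by (intro Min_le) auto
  have "{j. X.nb (p - 1) j} \<noteq> {}"
    using X.degree_last two_le_degree by (intro notI) simp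
  then have "X.nb (p - 1) b"
    unfolding b_def using Min_in[OF X.finite_nb] by blast
  then have b: "X.nb b (p - 1)" using X.nb_sym by simp
  show ?thesis
  proof (cases "a \<le> b")
    case True
    \<comment> \<open>\<open>2 * \<delta> \<le> a + 1 \<le> b + 1\<close> and
      \<open>\<delta> + b + 1 \<le> p\<close>.\<close>
    then show ?thesis using X.degree_last_nbr_bound[OF b_le] a2 by simp
  next
    case False
    \<comment> \<open>For \<open>b = 0\<close> the last vertex would be a neighbour of
      \<open>x_0\<close> beyond \<open>x_a\<close>.\<close>
    have "0 < b" using a_max[of "p - 1"] b ap by (cases b) auto
    let ?C = "map ((!) xs) ([0..<Suc b] @ rev [a..<p])" and ?Q = "map ((!) xs) [Suc b..<a]"
    have C: "is_cycle ?C"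
      using X.crossing_cycle[OF a b \<open>0 < b\<close> _ ap] False by simp
    have len: "length ?C = b + 1 + p - a" using ap by simp
    have lt: "Suc b < a"
      using cycle_length_le[OF C] len assms(3) False by simp
    have "is_path ?Q"
      using lt ap by (intro X.is_path_map_nth) auto
    moreover have "set ?C \<inter> set ?Q = {}"
    proof -
      have "xs ! i \<noteq> xs ! j" if "i \<in> set ([0..<Suc b] @ rev [a..<p])" "j \<in> set [Suc b..<a]" for i j
        using that ap lt X.nth_xs_eq[of i j] by auto
      then show ?thesis unfolding set_map by blast
    qed
    moreover have "length ?C + length ?Q = p" using len lt ap by simp
    moreover have "xs ! b \<in> set ?C" "xs ! a \<in> set ?C" using ap by auto
    moreover have "xs ! b \<noteq> xs ! a" using X.nth_xs_eq lt ap by simp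
    moreover have "adj (hd ?Q) (xs ! b)"
      using X.nb_Suc[of b] X.nb_sym[of b "Suc b"] lt ap by (simp add: hd_map X.nb_def)
    moreover have "adj (last ?Q) (xs ! a)"
      using X.nb_Suc[of "a - 1"] lt ap by (simp add: last_map X.nb_def)
    ultimately have "cycle_with_ear ?C ?Q"
      using C unfolding cycle_with_ear_def by blast
    then show ?thesis using ear_degree_bound assms(3) by blast
  qed
qed

section \<open>Vines on a longest path\<close>

context ugraph
begin

lemma successively_subset_V: "successively adj (x # K) \<Longrightarrow> set K \<subseteq> V"
proof (induction K arbitrary: x)
  case (Cons y K)
  then show ?case using adj_V2 by (auto simp: successively_Cons)
qed simp

lemma is_path_append:
  assumes "is_path F" "successively adj (last F # K)" "distinct K" "set F \<inter> set K = {}"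
  shows "is_path (F @ K)"
  using assms successively_subset_V[OF assms(2)]
  by (auto simp: is_path_def successively_append_iff successively_Cons)

lemma is_cycle_append:
  assumes "is_path F" "successively adj (last F # K @ [hd F])" "distinct K" "set F \<inter> set K = {}"
    "3 \<le> length F + length K"
  shows "is_cycle (F @ K)"
proof -
  have "successively adj (last F # K)"
    using assms(2) by (auto simp: successively_append_iff successively_Cons hd_append split: if_splits)
  then have "is_path (F @ K)" using is_path_append assms by blast
  moreover have "adj (last (F @ K)) (hd (F @ K))"
    using assms(1,2) by (auto simp: successively_append_iff successively_Cons is_path_def hd_append split: if_splits)
  ultimately show ?thesis using assms(5) by (simp add: is_cycle_def)
qed

end

section \<open>Connections outside the path\<close>

context longest_path
begin

text \<open>Here \<open>q\<close> may be empty or repeat vertices, and \<open>y\<close> may lie on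
  or off the path. Such walks are easy to extend and to join; \<open>attached_distinct\<close>
  recovers a path.\<close>

definition attached :: "nat \<Rightarrow> 'a \<Rightarrow> bool" where
  "attached i y \<longleftrightarrow> i < p \<and> (\<exists>q. set q \<inter> set xs = {} \<and> successively adj (xs ! i # q @ [y]))"

lemma attached_step:
  assumes "attached i y" "y \<notin> set xs" "adj y z"
  shows "attached i z"
proof -
  obtain q where "i < p" "set q \<inter> set xs = {}" "successively adj (xs ! i # q @ [y])"
    using assms(1) by (auto simp: attached_def)
  then show ?thesis unfolding attached_def using assms(2,3)
    by (intro conjI exI[of _ "q @ [y]"]) (auto simp: successively_append_iff successively_Cons hd_append split: if_splits)
qed

lemma attached_edge: "i < p \<Longrightarrow> adj (xs ! i) y \<Longrightarrow> attached i y"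
  unfolding attached_def by (intro conjI exI[of _ "[]"]) auto

lemma attached_join:
  assumes "attached i y" "set q \<inter> set xs = {}" "successively adj (x # q @ [z])" "y \<in> set q"
  shows "attached i z"
proof -
  obtain q0 where q0: "i < p" "set q0 \<inter> set xs = {}" "successively adj (xs ! i # q0 @ [y])"
    using assms(1) by (auto simp: attached_def)
  obtain q1 q2 where q: "q = q1 @ y # q2" using assms(4) by (meson split_list)
  show ?thesis unfolding attached_def
  proof (intro conjI exI[of _ "q0 @ y # q2"])
    show "set (q0 @ y # q2) \<inter> set xs = {}" using q0 assms(2) q by auto
    show "successively adj (xs ! i # (q0 @ y # q2) @ [z])"
      using q0(3) assms(3) q by (auto simp: successively_append_iff successively_Cons hd_append split: if_splits)
  qed fact
qed

lemma attached_distinct: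
  assumes "attached i y"
  obtains q where "set q \<inter> set xs = {}" "successively adj (xs ! i # q @ [y])" "distinct q"
proof -
  let ?P = "\<lambda>q. set q \<inter> set xs = {} \<and> successively adj (xs ! i # q @ [y])"
  obtain q where q: "?P q" and min: "\<And>q'. ?P q' \<Longrightarrow> length q \<le> length q'"
    using assms ex_has_least_nat[of ?P _ length] unfolding attached_def by metis
  have "distinct q"
  proof (rule ccontr)
    assume "\<not> distinct q"
    then obtain ys w zs us where d: "q = ys @ [w] @ zs @ [w] @ us"
      using not_distinct_decomp by blast
    have "?P (ys @ w # us)"
      using q d by (auto simp: successively_append_iff successively_Cons hd_append split: if_splits)
    then show False using min[of "ys @ w # us"] d by simp
  qed
  then show thesis using that q by blast
qed

text \<open>A vertex off the path adjacent to its end would extend a longest path.\<close>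

lemma attached_last: "attached i (xs ! (p - 1)) \<Longrightarrow> nb i (p - 1)"
proof -
  assume "attached i (xs ! (p - 1))"
  then obtain q where q: "i < p" "set q \<inter> set xs = {}" "successively adj (xs ! i # q @ [xs ! (p - 1)])"
    by (auto simp: attached_def)
  have "q = []"
  proof (rule ccontr)
    assume "q \<noteq> []"
    then have "adj (last q) (xs ! (p - 1))"
      using q(3) by (auto simp: successively_append_iff successively_Cons hd_append split: if_splits)
    then have "last q \<in> set xs" using last_nbr_in_xs adj_sym by blast
    then show False using q(2) \<open>q \<noteq> []\<close> last_in_set[of q] by blast
  qed
  then show ?thesis using q p_pos by (simp add: nb_def)
qed

text \<open>Let \<open>X\<close> consist of the vertices before \<open>x_t\<close> and all vertices
  off the path attached to them. An edge leaving \<open>X\<close> in the graph minus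
  \<open>x_t\<close> cannot end off the path, since its end would be attached too, so it ends beyond
  \<open>x_t\<close>.\<close>

lemma attached_across:
  assumes "0 < t" "t + 1 < p"
  shows "\<exists>i<t. \<exists>j>t. j < p \<and> attached i (xs ! j)"
proof (rule ccontr)
  assume no: "\<not> ?thesis"
  define X where "X = (!) xs ` {..<t} \<union> {y \<in> V. y \<notin> set xs \<and> (\<exists>i<t. attached i y)}"
  have tp: "t < p" using assms by simp
  have notin: "xs ! j \<notin> X" if "t \<le> j" "j < p" for j
  proof -
    have "xs ! j \<in> set xs" using that length_xs by simp
    moreover have "xs ! j \<notin> (!) xs ` {..<t}"
    proof
      assume "xs ! j \<in> (!) xs ` {..<t}"
      then obtain i where "i < t" "xs ! j = xs ! i" by auto
      then show False using nth_xs_eq[of j i] that by simp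
    qed
    ultimately show ?thesis by (auto simp: X_def)
  qed
  have "X \<subseteq> V - {xs ! t}"
  proof -
    have "X \<subseteq> V" using tp nth_xs_in_V by (auto simp: X_def)
    then show ?thesis using notin[of t] tp by blast
  qed
  moreover have "X \<noteq> {}" using assms by (auto simp: X_def)
  moreover have "X \<noteq> V - {xs ! t}"
  proof -
    have "xs ! (p - 1) \<in> V - {xs ! t}" using nth_xs_eq[of "p - 1" t] nth_xs_in_V assms by simp
    moreover have "xs ! (p - 1) \<notin> X" by (rule notin) (use assms in auto)
    ultimately show ?thesis by blast
  qed
  ultimately obtain x y where xy: "x \<in> X" "y \<in> V - {xs ! t} - X" "adj x y"
    using no_cut_vertex[OF nth_xs_in_V[OF tp]] by blast
  obtain i where i: "i < t" "attached i y"
  proof (cases "x \<in> set xs")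
    case True
    then obtain i where "i < t" "x = xs ! i" using xy(1) by (auto simp: X_def)
    then show thesis using that attached_edge xy(3) tp by simp
  next
    case False
    then obtain i where "i < t" "attached i x"
      using xy(1) length_xs tp by (auto simp: X_def)
    then show thesis using that attached_step False xy(3) by blast
  qed
  have "y \<in> set xs" using xy(2) i by (auto simp: X_def)
  then obtain j where j: "j < p" "y = xs ! j" using length_xs by (auto simp: in_set_conv_nth)
  have "t < j"
  proof (rule ccontr)
    assume "\<not> t < j"
    then have "j < t \<or> j = t" by auto
    then show False using xy(2) j by (auto simp: X_def)
  qed
  then show False using no i j by auto
qed

text \<open>The greedy choice of the vine: by maximality of \<open>v\<close>, a connection going
  beyond \<open>x_v\<close> can neither start before \<open>x_u\<close> nor meet, off the path, one
  that does.\<close>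

definition reach :: "nat \<Rightarrow> nat \<Rightarrow> bool" where
  "reach u v \<longleftrightarrow> v < p \<and> (\<exists>i<u. attached i (xs ! v)) \<and>
     (\<forall>i<u. \<forall>j<p. attached i (xs ! j) \<longrightarrow> j \<le> v)"

lemma reachD: "reach u v \<Longrightarrow> i < u \<Longrightarrow> attached i (xs ! j) \<Longrightarrow> j < p \<Longrightarrow> j \<le> v"
  unfolding reach_def by blast

lemma reach_exists:
  assumes "0 < t" "t + 1 < p"
  obtains v where "t < v" "reach t v"
proof -
  let ?S = "{j. j < p \<and> (\<exists>i<t. attached i (xs ! j))}"
  obtain i j where ij: "i < t" "t < j" "j < p" "attached i (xs ! j)"
    using attached_across[OF assms] by blast
  have fin: "finite ?S" by simp
  have "j \<in> ?S" using ij by blast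
  then have "Max ?S \<in> ?S" "j \<le> Max ?S" using fin Max_in[of ?S] Max_ge[of ?S j] by blast+
  then have "reach t (Max ?S)" unfolding reach_def using fin Max_ge[OF fin] by blast
  then show thesis using that[of "Max ?S"] \<open>j \<le> Max ?S\<close> ij(2) by simp
qed

text \<open>The connection closes the stretch from \<open>x_i\<close> to \<open>x_j\<close>. If
  \<open>j = i + 1\<close>, it may be an edge of the path itself, and \<open>2 \<le> c\<close>
  replaces the cycle.\<close>

lemma attached_cycle:
  assumes "attached i (xs ! j)" "i < j" "j < p" "2 \<le> c"
  shows "j - i + 1 \<le> c"
proof (cases "j = i + 1")
  case True
  then show ?thesis using assms(4) by simp
next
  case False
  obtain q where q: "set q \<inter> set xs = {}" "successively adj (xs ! i # q @ [xs ! j])" "distinct q"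
    using attached_distinct[OF assms(1)] .
  let ?F = "map ((!) xs) [i..<Suc j]"
  have "is_path ?F" using assms by (intro is_path_map_nth) (auto simp del: upt_Suc)
  moreover have "successively adj (last ?F # rev q @ [hd ?F])"
  proof -
    have "successively adj (rev (xs ! i # q @ [xs ! j]))"
      using q(2) by (simp only: successively_rev successively_adj_flip)
    then show ?thesis using assms by (simp add: last_map hd_map del: upt_Suc)
  qed
  moreover have "set ?F \<inter> set (rev q) = {}"
    using q(1) assms(3) length_xs by auto
  ultimately have "is_cycle (?F @ rev q)"
    using q(3) assms(2) False by (intro is_cycle_append) auto
  from cycle_length_le[OF this] show ?thesis using assms by simp
qed

text \<open>
  The cycle through a vine visits the connections alternately from left to right and from right to
  left, so its two strands over a cut of the path are joined only to the left. Such a partial cycle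
  runs between the two most recent right ends \<open>x\<^sub>u\<close> and \<open>x\<^sub>v\<close>. The last clause implies, if \<open>reach u v\<close>,
  that a connection reaching beyond \<open>x\<^sub>v\<close> does not meet it.
\<close>

definition vine_path :: "nat \<Rightarrow> nat \<Rightarrow> nat \<Rightarrow> bool" where
  "vine_path u v l \<longleftrightarrow> (\<exists>F. is_path F \<and> hd F = xs ! u \<and> last F = xs ! v \<and> l \<le> length F \<and>
     (\<forall>y\<in>set F. (\<exists>j\<le>u. y = xs ! j) \<or> y = xs ! v \<or> y \<notin> set xs \<and> (\<exists>i<u. attached i y)))"

lemma attached_prefix:
  assumes "i < p" "set q \<inter> set xs = {}" "successively adj (xs ! i # q @ [z])" "y \<in> set q"
  shows "attached i y"
proof -
  obtain q1 q2 where "q = q1 @ y # q2" using assms(4) by (meson split_list)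
  then show ?thesis unfolding attached_def using assms
    by (intro conjI exI[of _ q1]) (auto simp: successively_append_iff successively_Cons hd_append split: if_splits)
qed

text \<open>\<open>ks\<close> is run backwards from \<open>x_a\<close> to \<open>x_s\<close>, then
  the connection leads to \<open>x_v\<close>. Leaving \<open>ks\<close> free allows a start through
  \<open>x_0\<close> as well as the direct stretch from \<open>x_s\<close> to
  \<open>x_a\<close>.\<close>

lemma vine_path_start:
  assumes "ks \<noteq> []" "distinct ks" "set ks \<subseteq> {..a}" "successively nb ks" "hd ks = s" "last ks = a"
    and "s < a" "a < v" "v < p" "attached s (xs ! v)"
  shows "vine_path a v (length ks + 1)"
proof -
  obtain q where q: "set q \<inter> set xs = {}" "successively adj (xs ! s # q @ [xs ! v])" "distinct q"
    using attached_distinct[OF assms(10)] .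
  let ?F = "map ((!) xs) (rev ks)" and ?K = "q @ [xs ! v]"
  have ks: "set ks \<subseteq> {..<p}" using assms(3,8,9) by auto
  have F: "is_path ?F"
    unfolding rev_map[symmetric] is_path_rev using is_path_map_nth assms ks by blast
  have "is_path (?F @ ?K)"
  proof (rule is_path_append[OF F])
    show "successively adj (last ?F # ?K)" using q(2) assms(1,5) by (simp add: last_map last_rev)
    have "xs ! v \<in> set xs" using assms(9) length_xs by simp
    then show "distinct ?K" using q(1,3) by auto
    have "xs ! v \<notin> set ?F"
    proof
      assume "xs ! v \<in> set ?F"
      then obtain k where "k \<in> set ks" "xs ! v = xs ! k" by auto
      then show False using nth_xs_eq[of v k] assms(3,8,9) by fastforce
    qed
    moreover have "set ?F \<subseteq> set xs" using ks length_xs by auto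
    ultimately show "set ?F \<inter> set ?K = {}" using q(1) by auto
  qed
  moreover have "hd (?F @ ?K) = xs ! a" using assms(1,6) by (simp add: hd_map hd_rev)
  moreover have "last (?F @ ?K) = xs ! v" by simp
  moreover have "length ks + 1 \<le> length (?F @ ?K)" by simp
  moreover have "(\<exists>j\<le>a. y = xs ! j) \<or> y = xs ! v \<or> y \<notin> set xs \<and> (\<exists>i<a. attached i y)"
    if "y \<in> set (?F @ ?K)" for y
  proof -
    have "y \<in> set ?F \<or> y \<in> set q \<or> y = xs ! v"
      using that unfolding set_append by auto
    then consider "y \<in> set ?F" | "y \<in> set q" | "y = xs ! v" by blast
    then show ?thesis
    proof cases
      case 1
      then show ?thesis using assms(3) by auto
    next
      case 2
      have "s < p" using assms by simp
      then have "attached s y" using attached_prefix[OF _ q(1,2) 2] by simp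
      then show ?thesis using 2 q(1) assms(7) by blast
    qed simp
  qed
  ultimately show ?thesis unfolding vine_path_def by blast
qed

text \<open>The partial cycle is reversed, continued along the path from \<open>x_u\<close> to
  \<open>x_s\<close> and over the new connection to \<open>x_{v'}\<close>. By
  \<open>reach u v\<close> the new connection avoids the old part.\<close>

lemma vine_path_step:
  assumes "vine_path u v l" "u < v" "reach u v" "u \<le> s" "s < v" "v < v'" "v' < p"
    and "attached s (xs ! v')"
  shows "vine_path v v' (l + (s - u) + 1)"
proof -
  obtain F where F: "is_path F" "hd F = xs ! u" "last F = xs ! v" "l \<le> length F"
    and Fset: "\<And>y. y \<in> set F \<Longrightarrow>
      (\<exists>j\<le>u. y = xs ! j) \<or> y = xs ! v \<or> y \<notin> set xs \<and> (\<exists>i<u. attached i y)"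
    using assms(1) unfolding vine_path_def by blast
  obtain q where q: "set q \<inter> set xs = {}" "successively adj (xs ! s # q @ [xs ! v'])" "distinct q"
    using attached_distinct[OF assms(8)] .
  let ?S = "map ((!) xs) [Suc u..<Suc s]"
  let ?K = "?S @ q @ [xs ! v']"
  have F_idx: "j \<le> u \<or> j = v" if "xs ! j \<in> set F" "j < p" for j
    using Fset[OF that(1)] nth_xs_eq that(2) assms length_xs by fastforce
  have v': "xs ! v' \<in> set xs" using assms(7) length_xs by simp
  have S: "set ?S \<subseteq> set xs" using assms length_xs by auto
  have "is_path (rev F @ ?K)"
  proof (rule is_path_append)
    show "is_path (rev F)" using F(1) by simp
    have *: "successively adj (xs ! u # ?S)"
    proof -
      have "successively adj (map ((!) xs) (u # [Suc u..<Suc s]))"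
        using assms by (intro successively_adj_map) (auto simp: upt_conv_Cons[symmetric] simp del: upt_Suc)
      then show ?thesis by simp
    qed
    have "last (xs ! u # ?S) = xs ! s"
      using assms(4) by (cases "u = s") (auto simp: last_map)
    then have "successively adj ((xs ! u # ?S) @ q @ [xs ! v'])"
      using * q(2) unfolding successively_append_iff[of _ "xs ! u # ?S"]
      by (simp add: successively_Cons)
    then show "successively adj (last (rev F) # ?K)" using F(2) by (simp add: last_rev)
    have "distinct ?S" using assms by (intro distinct_map_nth) auto
    moreover have "xs ! v' \<notin> set ?S"
    proof
      assume "xs ! v' \<in> set ?S"
      then obtain k where "k \<in> set [Suc u..<Suc s]" "xs ! v' = xs ! k"
        unfolding set_map by blast
      then show False using nth_xs_eq[of v' k] assms(5-7) by auto
    qed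
    moreover have "set ?S \<inter> set q = {}" "xs ! v' \<notin> set q" using S v' q(1) by blast+
    ultimately show "distinct ?K" using q(3) by auto
    have "xs ! v' \<notin> set F" using F_idx[of v'] assms by auto
    moreover have "set F \<inter> set ?S = {}"
    proof -
      have "xs ! k \<notin> set F" if "k \<in> set [Suc u..<Suc s]" for k
        using F_idx[of k] that assms by auto
      then show ?thesis by auto
    qed
    moreover have "set F \<inter> set q = {}"
    proof -
      have False if y: "y \<in> set F" "y \<in> set q" for y
      proof -
        have "y \<notin> set xs" using y q(1) by blast
        moreover have "xs ! j \<in> set xs" if "j \<le> v" for j using that assms length_xs by simp
        ultimately obtain i where "i < u" "attached i y" using Fset[OF y(1)] assms(2) by fastforce
        then have "attached i (xs ! v')" using attached_join[OF _ q(1,2) y(2)] by blast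
        then show False using reachD[OF assms(3) \<open>i < u\<close>] assms(6,7) by fastforce
      qed
      then show ?thesis by blast
    qed
    ultimately show "set (rev F) \<inter> set ?K = {}" by auto
  qed
  moreover have "hd (rev F @ ?K) = xs ! v" using F(1,3) by (simp add: is_path_def hd_rev)
  moreover have "last (rev F @ ?K) = xs ! v'" by simp
  moreover have "l + (s - u) + 1 \<le> length (rev F @ ?K)" using F(4) by (simp del: upt_Suc)
  moreover have "(\<exists>j\<le>v. y = xs ! j) \<or> y = xs ! v' \<or> y \<notin> set xs \<and> (\<exists>i<v. attached i y)"
    if "y \<in> set (rev F @ ?K)" for y
  proof -
    have "y \<in> set F \<or> y \<in> set ?S \<or> y \<in> set q \<or> y = xs ! v'"
      using that unfolding set_append set_rev by (auto simp del: upt_Suc)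
    then consider "y \<in> set F" | "y \<in> set ?S" | "y \<in> set q" | "y = xs ! v'" by blast
    then show ?thesis
    proof cases
      case 1
      then show ?thesis using Fset[of y] assms(2) by (meson less_imp_le less_le_trans order_trans order_refl)
    next
      case 2
      then obtain k where "k \<in> set [Suc u..<Suc s]" "y = xs ! k" unfolding set_map by blast
      then show ?thesis using assms(5) by (intro disjI1 exI[of _ k]) auto
    next
      case 3
      have "s < p" using assms by simp
      then have "attached s y" using attached_prefix[OF _ q(1,2) 3] by simp
      then show ?thesis using 3 q(1) assms(5) by blast
    qed simp
  qed
  ultimately show ?thesis unfolding vine_path_def by blast
qed

text \<open>The cycle closes through \<open>M\<close> from \<open>x_v\<close> to \<open>x_b\<close>
  and down the path from \<open>x_b\<close> to \<open>x_u\<close>.\<close>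

lemma vine_path_close:
  assumes "vine_path u v l" "u < v" "v < p" "u \<le> b" "b < v" "3 \<le> l"
    and M: "distinct M" "set M \<subseteq> {b<..<p} - {v}" "successively nb (v # M @ [b])"
  shows "l + length M + (b - u) \<le> c"
proof -
  obtain F where F: "is_path F" "hd F = xs ! u" "last F = xs ! v" "l \<le> length F"
    and Fset: "\<And>y. y \<in> set F \<Longrightarrow>
      (\<exists>j\<le>u. y = xs ! j) \<or> y = xs ! v \<or> y \<notin> set xs \<and> (\<exists>i<u. attached i y)"
    using assms(1) unfolding vine_path_def by blast
  define K where "K = M @ rev [Suc u..<Suc b]"
  have F_idx: "j \<le> u \<or> j = v" if "xs ! j \<in> set F" "j < p" for j
    using Fset[OF that(1)] nth_xs_eq that(2) assms(2,3) length_xs by fastforce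
  have K: "set K \<subseteq> {u<..<p} - {v}" "distinct K"
    using M(1,2) assms(2-5) by (auto simp: K_def)
  have nbK: "successively nb (v # K @ [u])"
  proof (cases "u = b")
    case True
    then show ?thesis using M(3) by (simp add: K_def)
  next
    case False
    then have "u < b" using assms(4) by simp
    have "rev [Suc u..<Suc b] @ [u] = rev [u..<Suc b]"
      using \<open>u < b\<close> by (simp add: upt_conv_Cons)
    then have e: "v # K @ [u] = (v # M) @ rev [u..<Suc b]" by (simp add: K_def)
    show ?thesis unfolding e
      using M(3) \<open>u < b\<close> assms(3,5)
      unfolding successively_append_iff[of _ "v # M"] append_Cons[symmetric]
      by (simp add: hd_rev del: upt_Suc)
  qed
  have "successively adj (map ((!) xs) (v # K @ [u]))"
    by (rule successively_adj_map[OF _ nbK]) (use K assms(2,3) in auto)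
  then have adjK: "successively adj (last F # map ((!) xs) K @ [hd F])" using F by simp
  have "is_cycle (F @ map ((!) xs) K)"
  proof (rule is_cycle_append[OF F(1) adjK])
    show "distinct (map ((!) xs) K)" using K by (intro distinct_map_nth) auto
    have "xs ! k \<notin> set F" if "k \<in> set K" for k
      using F_idx[of k] that K by auto
    then show "set F \<inter> set (map ((!) xs) K) = {}" by auto
    show "3 \<le> length F + length (map ((!) xs) K)" using F(4) assms(6) by simp
  qed
  from cycle_length_le[OF this] show ?thesis using F(4) by (simp add: K_def del: upt_Suc)
qed

text \<open>The vine is extended greedily until the next connection reaches the last vertex.
  \<open>k\<close> is to count the connections so far and \<open>w\<close> the vertices that they
  add to both partial cycles. The inequality sums the bounds from \<open>attached_cycle\<close>; it
  telescopes because a step adds \<open>s - u + 1\<close> to \<open>w\<close>.\<close>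

lemma vine_progress:
  assumes "2 \<le> c" "u < v" "v + 1 < p" "reach u v" "k \<le> w" "1 \<le> k" "v + u + 2 * k \<le> k * c + r + w"
    and "vine_path u v (l + w)" "vine_path u v (l' + w)"
  shows "\<exists>u v k w. u < v \<and> v + 1 < p \<and> reach u v \<and> reach v (p - 1) \<and> 1 \<le> k \<and> k \<le> w \<and>
    v + u + 2 * k \<le> k * c + r + w \<and> vine_path u v (l + w) \<and> vine_path u v (l' + w)"
  using assms(2-)
proof (induction "p - v" arbitrary: u v k w rule: less_induct)
  case less
  have "0 < v" using less.prems by simp
  obtain v' where v': "v < v'" "reach v v'"
    using reach_exists[OF \<open>0 < v\<close> less.prems(2)] .
  show ?case
  proof (cases "v' = p - 1")
    case True
    then show ?thesis using less.prems v' by blast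
  next
    case False
    have v'p: "v' < p" using v'(2) by (simp add: reach_def)
    obtain s where s: "s < v" "attached s (xs ! v')" using v'(2) by (auto simp: reach_def)
    \<comment> \<open>A connection from before \<open>x_u\<close> reaches no further than
      \<open>x_v\<close>.\<close>
    have us: "u \<le> s"
    proof (rule ccontr)
      assume "\<not> u \<le> s"
      then have "v' \<le> v" using reachD[OF less.prems(3) _ s(2) v'p] by simp
      then show False using v'(1) by simp
    qed
    have cyc: "v' - s + 1 \<le> c"
      using attached_cycle[OF s(2) _ v'p assms(1)] s(1) v'(1) by simp
    define w' where "w' = w + (s - u) + 1"
    have lin: "vine_path v v' (m + w')" if "vine_path u v (m + w)" for m
      using vine_path_step[OF that less.prems(1,3) us s(1) v'(1) v'p s(2)]
      by (simp add: w'_def add.assoc)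
    have num: "v' + v + 2 * (k + 1) \<le> (k + 1) * c + r + w'"
    proof -
      have *: "v' + 1 \<le> c + s" "w' + u = w + s + 1"
        using cyc us s(1) v'(1) by (simp_all add: w'_def)
      define x where "x = k * c"
      have e: "(k + 1) * c = x + c" by (simp add: x_def)
      show ?thesis unfolding e using * less.prems(6)[folded x_def] by (simp add: algebra_simps)
    qed
    show ?thesis
    proof (rule less.hyps)
      show "p - v' < p - v" using v'(1) v'p by simp
      show "v' + 1 < p" using False v'p by simp
      show "k + 1 \<le> w'" using less.prems(4) by (simp add: w'_def)
    qed (use lin[OF less.prems(7)] lin[OF less.prems(8)] num v' in simp_all)
  qed
qed

text \<open>Here \<open>k\<close> is one less than the number of connections of the vine, counting
  the edges at both ends of the path. The first inequality sums \<open>k + 2\<close> cycles, the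
  second comes from the cycle through the whole vine.\<close>

lemma vine_bound:
  assumes a: "nb 0 a" "\<And>j. nb 0 j \<Longrightarrow> j \<le> a" "a + 1 < p" and c: "2 * \<delta> \<le> c"
  shows "\<exists>k\<ge>1. 2 * p + 4 * k \<le> (k + 2) * c + 2 \<and> 2 * \<delta> + k \<le> c + 1"
proof -
  have "\<delta> \<le> a" using degree_le_first_nbr_bound a(2) by blast
  define b where "b = Min {j. nb (p - 1) j}"
  have b_le: "b \<le> j" if "nb (p - 1) j" for j
    unfolding b_def using that finite_nb by (intro Min_le) auto
  have "{j. nb (p - 1) j} \<noteq> {}"
    using degree_last two_le_degree by (intro notI) simp
  then have nbb: "nb (p - 1) b"
    unfolding b_def using Min_in[OF finite_nb] by blast
  then have b: "nb b (p - 1)" using nb_sym by simp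
  have bp: "\<delta> + b + 1 \<le> p" using degree_last_nbr_bound b_le by blast
  show ?thesis
  proof (cases "b < a")
    case True
    have "0 < b" using a(2)[of "p - 1"] b a(3) by (cases b) auto
    have "b + 1 + (p - a) \<le> c"
      using cycle_length_le[OF crossing_cycle[OF a(1) b \<open>0 < b\<close> True a(3)]] by simp
    moreover have "a + 1 \<le> c"
      using first_index_cycle a(1) \<open>\<delta> \<le> a\<close> two_le_degree by simp
    moreover have "p - b \<le> c"
    proof -
      have "{b..<p} \<subseteq> {..<p}" "3 \<le> p - b" using bp two_le_degree by auto
      then show ?thesis using index_cycle_le[of "[b..<p]"] nbb by simp
    qed
    \<comment> \<open>With two connections, the three cycles have \<open>2 * p + 2\<close> vertices
      in total.\<close>
    ultimately have "2 * p + 4 * 1 \<le> (1 + 2) * c + 2" using a(3) bp by simp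
    then show ?thesis using c by (intro exI[of _ 1]) simp
  next
    case False
    have "0 < a" using \<open>\<delta> \<le> a\<close> two_le_degree by simp
    obtain v0 where v0: "a < v0" "reach a v0" using reach_exists[OF \<open>0 < a\<close> a(3)] .
    then obtain s where s: "s < a" "attached s (xs ! v0)" and v0p: "v0 < p"
      by (auto simp: reach_def)
    \<comment> \<open>Otherwise the connection would be an edge, making \<open>s < a \<le> b\<close>
      the index of a neighbour of the last vertex.\<close>
    have "v0 \<noteq> p - 1"
    proof
      assume "v0 = p - 1"
      then have "nb (p - 1) s" using attached_last s(2) nb_sym by simp
      then show False using b_le s(1) False by fastforce
    qed
    then have v0p': "v0 + 1 < p" using v0p by simp
    \<comment> \<open>The long cycle runs from \<open>x_s\<close> back to \<open>x_0\<close>, jumps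
      to \<open>x_t\<close> and goes on to \<open>x_a\<close>. It skips no neighbour of
      \<open>x_0\<close>, so \<open>l\<close> is at least \<open>\<delta> + 1\<close>.\<close>
    define t where "t = Min {j. nb 0 j \<and> s < j}"
    have fin: "finite {j. nb 0 j \<and> s < j}" using finite_nb[of 0] by simp
    have "a \<in> {j. nb 0 j \<and> s < j}" using a(1) s(1) by simp
    then have "t \<in> {j. nb 0 j \<and> s < j}" and t_le: "\<And>j. nb 0 j \<Longrightarrow> s < j \<Longrightarrow> t \<le> j"
      unfolding t_def using Min_in[OF fin] Min_le[OF fin] by blast+
    then have t: "nb 0 t" "s < t" "t \<le> a" using a(2) by auto
    define l where "l = s + 1 + (a + 1 - t)"
    have l_deg: "\<delta> + 1 \<le> l"
    proof -
      have sub: "{j. nb 0 j} \<subseteq> {1..s} \<union> {t..a}"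
      proof
        fix j assume "j \<in> {j. nb 0 j}"
        then show "j \<in> {1..s} \<union> {t..a}"
          using a(2)[of j] t_le[of j] by (cases "s < j"; cases j) auto
      qed
      have "card {j. nb 0 j} \<le> card ({1..s} \<union> {t..a})" by (rule card_mono[OF _ sub]) simp
      also have "\<dots> \<le> s + (a + 1 - t)" using card_Un_le[of "{1..s}" "{t..a}"] by simp
      finally show ?thesis using degree_first by (simp add: l_def)
    qed
    have long: "vine_path a v0 (l + 1)"
    proof -
      have "vine_path a v0 (length (rev [0..<Suc s] @ [t..<Suc a]) + 1)"
        by (rule vine_path_start[OF _ _ _ _ _ _ s(1) v0(1) v0p s(2)])
          (use t s(1) a(1,3) in \<open>auto simp: successively_append_iff last_rev hd_append hd_rev last_append hd_upt simp del: upt_Suc\<close>)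
      then show ?thesis by (simp add: l_def del: upt_Suc)
    qed
    have short: "vine_path a v0 ((a + 1 - s) + 1)"
    proof -
      have "vine_path a v0 (length [s..<Suc a] + 1)"
        by (rule vine_path_start[OF _ _ _ _ _ _ s(1) v0(1) v0p s(2)])
          (use s(1) a(1,3) in \<open>auto simp del: upt_Suc\<close>)
      then show ?thesis by (simp del: upt_Suc)
    qed
    txt \<open>Twice the cycle through all of the vine, the cycle omitting both ends of the path, and the
      cycles formed by the path and one connection together traverse each edge of the path at least
      twice. The last kind is summed up in the invariant of the following step.\<close>
    have c2: "2 \<le> c" using c two_le_degree by simp
    have cyc: "v0 - s + 1 \<le> c" using attached_cycle[OF s(2) _ v0p c2] s(1) v0(1) by simp
    have num0: "v0 + a + 2 * 1 \<le> 1 * c + (a + s) + 1" using cyc s(1) v0(1) by linarith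
    obtain u v k w where st: "u < v" "v + 1 < p" "reach u v" "reach v (p - 1)" "1 \<le> k" "k \<le> w"
      "v + u + 2 * k \<le> k * c + (a + s) + w" "vine_path u v (l + w)" "vine_path u v (a + 1 - s + w)"
      using vine_progress[OF c2 v0(1) v0p' v0(2) le_refl le_refl num0 long short] by blast
    obtain i where "i < v" "attached i (xs ! (p - 1))" using st(4) by (auto simp: reach_def)
    then have i: "i < v" "nb (p - 1) i" using attached_last nb_sym by auto
    then have bv: "b < v" using b_le by fastforce
    have ub: "u \<le> b"
    proof (rule ccontr)
      assume "\<not> u \<le> b"
      moreover have "attached b (xs ! (p - 1))" using b attached_edge by (simp add: nb_def)
      ultimately have "p - 1 \<le> v" using reachD[OF st(3), of b "p - 1"] p_pos by simp
      then show False using st(2) by simp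
    qed
    \<comment> \<open>Mirror image of \<open>t\<close>: the long cycle jumps from the last vertex to
      \<open>x_z\<close> and skips none of its neighbours.\<close>
    define z where "z = Max {j. nb (p - 1) j \<and> j < v}"
    have fin': "finite {j. nb (p - 1) j \<and> j < v}" using finite_nb[of "p - 1"] by simp
    have "b \<in> {j. nb (p - 1) j \<and> j < v}" using nbb bv by simp
    then have "z \<in> {j. nb (p - 1) j \<and> j < v}" "b \<le> z"
      and z_ge: "\<And>j. nb (p - 1) j \<Longrightarrow> j < v \<Longrightarrow> j \<le> z"
      unfolding z_def using Max_in[OF fin'] Max_ge[OF fin'] by blast+
    then have z: "nb (p - 1) z" "z < v" "b \<le> z" by auto
    define m where "m = p - 1 - v + (z - b)"
    have m_deg: "\<delta> \<le> m + 1"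
    proof -
      have sub: "{j. nb (p - 1) j} \<subseteq> {b..z} \<union> {v..<p - 1}"
      proof
        fix j assume j: "j \<in> {j. nb (p - 1) j}"
        then have "j < p" "j \<noteq> p - 1" by (auto simp: nb_def adj_irrefl)
        then show "j \<in> {b..z} \<union> {v..<p - 1}"
          using b_le[of j] z_ge[of j] j by (cases "j < v") auto
      qed
      have "card {j. nb (p - 1) j} \<le> card ({b..z} \<union> {v..<p - 1})" by (rule card_mono[OF _ sub]) simp
      also have "\<dots> \<le> (z + 1 - b) + (p - 1 - v)" using card_Un_le[of "{b..z}" "{v..<p - 1}"] by simp
      finally show ?thesis using degree_last z(3) by (simp add: m_def)
    qed
    have vp: "v < p" using st(2) by simp
    have long_cycle: "l + w + m + (b - u) \<le> c"
    proof -
      let ?M = "[Suc v..<p] @ rev [Suc b..<Suc z]"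
      have "rev [Suc b..<Suc z] @ [b] = rev [b..<Suc z]"
        using z(3) by (simp add: upt_conv_Cons del: upt_Suc)
      then have e: "v # ?M @ [b] = [v..<p] @ rev [b..<Suc z]"
        using vp by (simp add: upt_conv_Cons del: upt_Suc)
      have "successively nb (v # ?M @ [b])"
        unfolding e using z vp by (simp add: successively_append_iff hd_rev del: upt_Suc)
      then have "l + w + length ?M + (b - u) \<le> c"
        using l_deg two_le_degree z bv vp
        by (intro vine_path_close[OF st(8,1) vp ub bv]) auto
      then show ?thesis by (simp add: m_def del: upt_Suc)
    qed
    have short_cycle: "a + 1 - s + w + (v - Suc b) + (b - u) \<le> c"
    proof -
      let ?M = "rev [Suc b..<v]"
      have "rev [Suc b..<v] @ [b] = rev [b..<v]"
        using bv by (simp add: upt_conv_Cons)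
      then have e: "v # ?M @ [b] = rev [b..<Suc v]" using bv by simp
      have "successively nb (v # ?M @ [b])"
        unfolding e using vp by (simp del: upt_Suc)
      then have "a + 1 - s + w + length ?M + (b - u) \<le> c"
        using s(1) st(5,6) vp
        by (intro vine_path_close[OF st(9,1) vp ub bv]) auto
      then show ?thesis by simp
    qed
    have "2 * \<delta> + (k + 1) \<le> c + 1"
      using long_cycle l_deg m_deg st(6) by simp
    moreover have "2 * p + 4 * (k + 1) \<le> (k + 1 + 2) * c + 2"
    proof -
      define x where "x = k * c"
      have e: "(k + 1 + 2) * c = x + 3 * c" by (simp add: algebra_simps x_def)
      \<comment> \<open>The parts \<open>a + 1 - t\<close> and \<open>z - b\<close> of the long
        cycle are bounded below by 1 and 0. Twice this inequality plus \<open>short_cycle\<close>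
        and \<open>st(7)\<close> gives the claim, since \<open>u \<le> b\<close> and
        \<open>k \<le> w\<close>.\<close>
      have "s + 2 + w + (p - 1 - v) + (b - u) \<le> c"
        using long_cycle t(2,3) by (simp add: l_def m_def)
      then have "s + 1 + w + p + b \<le> c + v + u" using ub st(2) by simp
      moreover have "a + w + v \<le> c + s + u" using short_cycle bv ub s(1) by simp
      ultimately show ?thesis unfolding e
        using st(6) st(7)[folded x_def] ub by simp
    qed
    ultimately show ?thesis by (intro exI[of _ "k + 1"]) simp
  qed
qed

end

section \<open>The square root bound\<close>

lemma (in two_connected_graph) circumference_sqrt_bound:
  assumes "is_path zs" "length zs = p" "2 * \<delta> \<le> p"
  shows "sqrt (2 * real p - 10 + (real \<delta> - 7 / 2)\<^sup>2) + real \<delta> + 1 / 2 \<le> real c"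
proof -
  interpret X: longest_path V adj \<delta> p c zs
    using assms by unfold_locales
  have c: "2 * \<delta> \<le> c" using dirac_bound[OF assms(1,2)] assms(3) by simp
  define a where "a = Max {j. X.nb 0 j}"
  have "{j. X.nb 0 j} \<noteq> {}"
    using X.degree_first two_le_degree by (intro notI) simp
  then have a: "X.nb 0 a" and a_max: "\<And>j. X.nb 0 j \<Longrightarrow> j \<le> a"
    unfolding a_def using Max_in[OF X.finite_nb] Max_ge[OF X.finite_nb] by blast+
  have "2 \<le> a" using X.degree_le_first_nbr_bound[OF a_max] two_le_degree by simp
  have c4: "4 \<le> real c" and c\<delta>: "2 * real \<delta> \<le> real c" using c two_le_degree by simp_all
  have key: "2 * real p - 10 \<le> (real c - 2 * real \<delta> + 3) * (real c - 4)"
  proof (cases "a + 1 < p")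
    case True
    obtain k where k: "1 \<le> k" "2 * p + 4 * k \<le> (k + 2) * c + 2" "2 * \<delta> + k \<le> c + 1"
      using X.vine_bound[OF a a_max True c] by blast
    have "real (2 * p + 4 * k) \<le> real ((k + 2) * c + 2)" using k(2) of_nat_mono by blast
    then have "2 * real p - 10 \<le> (real k + 2) * (real c - 4)" by (simp add: algebra_simps)
    also have "\<dots> \<le> (real c - 2 * real \<delta> + 3) * (real c - 4)"
      using k(3) c4 by (intro mult_right_mono) linarith+
    finally show ?thesis .
  next
    case False
    have "a + 1 \<le> c" using X.first_index_cycle[OF a \<open>2 \<le> a\<close>] .
    then have "p \<le> c" using False by simp
    then have "2 * real p - 10 \<le> 3 * (real c - 4)" using c4 by simp
    also have "\<dots> \<le> (real c - 2 * real \<delta> + 3) * (real c - 4)"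
      using c\<delta> c4 by (intro mult_right_mono) linarith+
    finally show ?thesis .
  qed
  have "sqrt (2 * real p - 10 + (real \<delta> - 7 / 2)\<^sup>2) \<le> real c - real \<delta> - 1 / 2"
  proof (rule real_le_lsqrt)
    show "0 \<le> real c - real \<delta> - 1 / 2" using c4 c\<delta> by linarith
    \<comment> \<open>\<open>(c - \<delta> - 1/2)^2 - (\<delta> - 7/2)^2 = (c - 2 * \<delta> + 3) *
      (c - 4)\<close>.\<close>
    show "2 * real p - 10 + (real \<delta> - 7 / 2)\<^sup>2 \<le> (real c - real \<delta> - 1 / 2)\<^sup>2"
      using key by (simp add: power2_eq_square algebra_simps)
  qed
  then show ?thesis by simp
qed

section \<open>Symmetric digraphs\<close>

lemma vpath_iff:
  "vpath ys G \<longleftrightarrow> ys \<noteq> [] \<and> distinct ys \<and> successively (dominates G) ys \<and> set ys \<subseteq> verts G"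
proof -
  have "set (vwalk_arcs ys) \<subseteq> arcs_ends G \<longleftrightarrow> successively (dominates G) ys"
    by (induction ys rule: vwalk_arcs.induct) auto
  then show ?thesis by (auto simp: vpath_def vwalk_def)
qed

context wf_digraph
begin

lemma successively_dominates_awalk:
  assumes "successively (dominates G) (x # zs)" "x \<in> verts G"
  shows "\<exists>es. awalk x es (last (x # zs)) \<and> awalk_verts x es = x # zs"
  using assms
proof (induction zs arbitrary: x)
  case Nil
  then show ?case by (intro exI[of _ "[]"]) (simp add: awalk_Nil_iff)
next
  case (Cons y zs)
  then have "x \<rightarrow> y" "y \<in> verts G" using adj_in_verts by auto
  then obtain es where es: "awalk y es (last (y # zs))" "awalk_verts y es = y # zs"
    using Cons by auto
  obtain e where "e \<in> arcs G" "tail G e = x" "head G e = y" using \<open>x \<rightarrow> y\<close> by blast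
  then show ?case
    using es by (intro exI[of _ "e # es"]) (auto simp: awalk_Cons_iff)
qed

lemma cycle_of_vertices:
  assumes "vpath ys G" "last ys \<rightarrow> hd ys" "length ys = n"
  shows "\<exists>es. cycle es \<and> length es = n"
proof -
  obtain y zs where ys: "ys = y # zs" using assms(1) by (cases ys) (auto simp: vpath_iff)
  have "successively (dominates G) (y # zs @ [y])"
    using assms ys by (auto simp: vpath_iff successively_append_iff successively_Cons hd_append)
  then obtain es where es: "awalk y es y" "awalk_verts y es = y # zs @ [y]"
    using successively_dominates_awalk[of y "zs @ [y]"] assms(1) ys by (auto simp: vpath_iff)
  have "length es = n" using length_awalk_verts[of y es] es(2) assms(3) ys by simp
  moreover have "cycle es"
    unfolding cycle_def using es assms(1) ys by (intro exI[of _ y]) (auto simp: vpath_iff)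
  ultimately show ?thesis by blast
qed

end

text \<open>Makes the set in \<open>circumference\<close> finite, so that its maximum bounds every
  cycle.\<close>

lemma (in fin_digraph) cycle_length_le_card:
  assumes "cycle es" shows "length es \<le> card (verts G)"
proof -
  obtain u where u: "awalk u es u" "distinct (tl (awalk_verts u es))"
    using assms by (auto simp: cycle_def)
  have "set (tl (awalk_verts u es)) \<subseteq> verts G"
  proof -
    have "set (awalk_verts u es) \<subseteq> verts G" using u(1) by blast
    then show ?thesis by (cases "awalk_verts u es") auto
  qed
  then have "length (tl (awalk_verts u es)) \<le> card (verts G)"
    using distinct_card[OF u(2)] card_mono[OF finite_verts] by metis
  then show ?thesis by (simp add: length_awalk_verts)
qed

context graph
begin

lemma card_nbrs: "card {w. v \<rightarrow> w} = out_degree G v"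
proof -
  have "{w. v \<rightarrow> w} = head G ` out_arcs G v"
    by (auto simp: arcs_ends_conv)
  moreover have "inj_on (head G) (out_arcs G v)"
    using no_multi_arcs by (auto simp: inj_on_def arc_to_ends_def)
  ultimately show ?thesis by (simp add: card_image out_degree_def)
qed

text \<open>Otherwise a walk in the graph minus \<open>w\<close> that starts in \<open>X\<close>
  could never leave \<open>X\<close>.\<close>

lemma two_connected_cut_edge:
  assumes "k_connected 2 G" "w \<in> verts G" "X \<subseteq> verts G - {w}" "X \<noteq> {}" "X \<noteq> verts G - {w}"
  shows "\<exists>x\<in>X. \<exists>y\<in>verts G - {w} - X. x \<rightarrow> y"
proof (rule ccontr)
  assume no: "\<not> ?thesis"
  let ?H = "G \<restriction> (verts G - {w})"
  have con: "Digraph_Component.connected ?H"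
    using assms(1,2) by (auto simp: k_connected_def)
  obtain x y where xy: "x \<in> X" "y \<in> verts G - {w} - X" using assms(3-5) by blast
  then have "(x, y) \<in> rtrancl_on (verts ?H) ((arcs_ends ?H)\<^sup>s)"
    using con assms(3) unfolding connected_conv by auto
  then have "y \<in> X"
  proof (induction rule: rtrancl_on_induct)
    case base
    then show ?case using xy by simp
  next
    case (step y z)
    have "y \<rightarrow> z"
      using step(2) arcs_ends_symmetric[OF sym_arcs] by (auto simp: symcl_def arcs_ends_conv image_iff)
    then show ?case using no step by auto
  qed
  then show False using xy by simp
qed

text \<open>A vertex with at most one neighbour is cut off by that neighbour, or by any other vertex
  if it has none; three vertices leave something to be cut off from.\<close>

lemma two_le_out_degree:
  assumes "k_connected 2 G" "v \<in> verts G"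
  shows "2 \<le> out_degree G v"
proof (rule ccontr)
  assume "\<not> ?thesis"
  then have "card {w. v \<rightarrow> w} \<le> 1" by (simp add: card_nbrs)
  moreover have "finite {w. v \<rightarrow> w}"
    by (rule finite_subset[OF _ finite_verts]) (auto dest: adj_in_verts)
  moreover have V: "3 \<le> card (verts G)" using assms(1) by (simp add: k_connected_def)
  then have "verts G - {v} \<noteq> {}" using card_mono[of "{v}" "verts G"] by auto
  ultimately obtain w where w: "w \<in> verts G - {v}" "{u. v \<rightarrow> u} \<subseteq> {w}"
  proof (cases "{w. v \<rightarrow> w} = {}")
    case True
    then show thesis using that \<open>verts G - {v} \<noteq> {}\<close> by blast
  next
    case False
    then obtain w where w: "v \<rightarrow> w" by blast
    then have "{u. v \<rightarrow> u} \<subseteq> {w}"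
      using \<open>card {w. v \<rightarrow> w} \<le> 1\<close> \<open>finite {w. v \<rightarrow> w}\<close> by (auto simp: card_le_Suc0_iff_eq)
    moreover have "w \<in> verts G - {v}" using w adj_in_verts adj_not_same by blast
    ultimately show thesis using that by blast
  qed
  have "{v} \<noteq> verts G - {w}"
  proof
    assume "{v} = verts G - {w}"
    then have "verts G \<subseteq> {v, w}" by blast
    then have "card (verts G) \<le> card {v, w}" by (intro card_mono) auto
    also have "\<dots> \<le> 2" by (simp add: card_insert_le_m1)
    finally show False using V by simp
  qed
  then obtain y where "v \<rightarrow> y" "y \<noteq> w"
    using two_connected_cut_edge[OF assms(1), of w "{v}"] w(1) assms(2) by blast
  then show False using w(2) by blast
qed

end

theorem theorem1:
  fixes G :: "('a, 'b) pre_digraph" and \<delta> p c :: nat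
  assumes "graph G"
    and "k_connected 2 G"
    and "\<delta> = min_degree G"
    and "p = longest_path_order G"
    and "c = circumference G"
  shows "(p \<le> 2 * \<delta> \<longrightarrow> c \<ge> p)
    \<and> (2 * \<delta> + 1 \<le> p \<and> real p \<le> 3 * real \<delta> - 2 \<longrightarrow> real c \<ge> real p - 1)
    \<and> (real p \<ge> 3 * real \<delta> - 1 \<longrightarrow>
         real c \<ge> sqrt (2 * real p - 10 + (real \<delta> - 7 / 2)\<^sup>2) + real \<delta> + 1 / 2)"
proof -
  interpret G: graph G by fact
  let ?adj = "dominates G" and ?L = "{length ys | ys. vpath ys G}"
    and ?C = "{length es | es. pre_digraph.cycle G es \<and> 3 \<le> length es}"
  have ug: "ugraph (verts G) ?adj"
    by (rule ugraph.intro)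
      (fact arcs_ends_symmetric[OF G.sym_arcs], blast dest: G.adj_not_same, fact G.adj_in_verts(1))
  have path_iff: "ugraph.is_path (verts G) ?adj ys \<longleftrightarrow> vpath ys G" for ys
    by (simp add: ugraph.is_path_def[OF ug] vpath_iff)
  have ne: "verts G \<noteq> {}" using assms(2) by (auto simp: k_connected_def)
  have "length ys \<le> card (verts G)" if "vpath ys G" for ys
    using that distinct_card[of ys] card_mono[OF G.finite_verts, of "set ys"]
    by (simp add: vpath_iff)
  then have finL: "finite ?L"
    by (auto simp: finite_nat_set_iff_bounded_le)
  have finC: "finite ?C"
    using G.cycle_length_le_card by (auto simp: finite_nat_set_iff_bounded_le)
  obtain v where "v \<in> verts G" using ne by blast
  then have "vpath [v] G" by (simp add: vpath_iff)
  then have "?L \<noteq> {}" by blast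
  then have "p \<in> ?L" using Max_in[OF finL] assms(4) by (simp add: longest_path_order_def)
  then obtain zs where zs: "vpath zs G" "length zs = p" by blast
  have "\<delta> \<in> out_degree G ` verts G"
    unfolding assms(3) min_degree_def using ne by (intro Min_in) auto
  then have \<delta>2: "2 \<le> \<delta>" using G.two_le_out_degree[OF assms(2)] by auto
  interpret T: two_connected_graph "verts G" ?adj \<delta> p c
  proof (intro two_connected_graph.intro two_connected_graph_axioms.intro)
    show "\<delta> \<le> card {w. v \<rightarrow>\<^bsub>G\<^esub> w}" if "v \<in> verts G" for v
      using that unfolding assms(3) min_degree_def G.card_nbrs by (intro Min_le) auto
    show "length ys \<le> p" if "ugraph.is_path (verts G) ?adj ys" for ys
      using that finL unfolding path_iff assms(4) longest_path_order_def by (intro Max_ge) auto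
    \<comment> \<open>\<open>c\<close> enters the argument only through this inequality, which is
      vacuous if there is no cycle and \<open>c\<close> is unspecified.\<close>
    show "length ys \<le> c" if "ugraph.is_cycle (verts G) ?adj ys" for ys
    proof -
      have ys: "vpath ys G" "3 \<le> length ys" "last ys \<rightarrow>\<^bsub>G\<^esub> hd ys"
        using that by (auto simp: ugraph.is_cycle_def[OF ug] path_iff)
      then obtain es where "G.cycle es" "length es = length ys"
        using G.cycle_of_vertices by blast
      then have "length ys \<in> ?C" using ys(2) by (metis (mono_tags, lifting) mem_Collect_eq)
      then show ?thesis using finC unfolding assms(5) circumference_def by (intro Max_ge) auto
    qed
    show "\<exists>x\<in>X. \<exists>y\<in>verts G - {w} - X. x \<rightarrow>\<^bsub>G\<^esub> y"
      if "w \<in> verts G" "X \<subseteq> verts G - {w}" "X \<noteq> {}" "X \<noteq> verts G - {w}" for w X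
      by (rule G.two_connected_cut_edge[OF assms(2) that])
  qed (fact ug \<delta>2)+
  have zs': "T.is_path zs" using zs(1) by (simp add: path_iff)
  have "p \<le> c" if "p \<le> 2 * \<delta>"
    using T.dirac_bound[OF zs' zs(2)] that by simp
  moreover have "real p - 1 \<le> real c" if "real p \<le> 3 * real \<delta> - 2"
  proof (rule ccontr)
    assume "\<not> ?thesis"
    then have "c + 2 \<le> p" by linarith
    then have "3 * \<delta> \<le> p + 1" by (rule T.relative_length_bound[OF zs' zs(2)])
    then show False using that by linarith
  qed
  moreover have "sqrt (2 * real p - 10 + (real \<delta> - 7 / 2)\<^sup>2) + real \<delta> + 1 / 2 \<le> real c"
    if "real p \<ge> 3 * real \<delta> - 1"
  proof (rule T.circumference_sqrt_bound[OF zs' zs(2)])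
    have "2 * real \<delta> \<le> real p" using that \<delta>2 by linarith
    then show "2 * \<delta> \<le> p" by linarith
  qed
  ultimately show ?thesis by blast
qed

end
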